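(* Let $\beta:\mathbb{Z}\to\mathbb{C}$ be a function for which both limits $\beta_{\pm\infty}:=\lim_{k\to\pm\infty}(\beta(k)-\beta(k-1))$ exist in $\mathbb{C}$, and let $c\in\mathbb{C}$. For either choice of sign $\pm$, let $D_{\beta,\tau_{\pm\infty}}$ and $\tilde D_{\beta,\tau_{\pm\infty}}$ be the closures in $L^2(S^1)$ of the operators defined on trigonometric polynomials by $$D_{\beta,\tau_{\pm\infty}}=\beta_{\pm\infty}\frac1i\frac{d}{dx}+c,\qquad \tilde D_{\beta,\tau_{\pm\infty}}=e^{ix}\left(\beta_{\pm\infty}\frac1i\frac{d}{dx}+c\right).$$ Then $D_{\beta,\tau_{\pm\infty}}$ has compact parametrices if and only if $\beta_{\pm\infty}\neq0$, and $\tilde D_{\beta,\tau_{\pm\infty}}$ has compact parametrices if and only if $\beta_{\pm\infty}\ne0$ (with the same choice of sign throughout).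
   Context: A closed (densely defined) operator $D$ has compact parametrices if $(1+D^*D)^{-1/2}$ and $(1+DD^* )^{-1/2}$ are compact operators. Trigonometric polynomials are finite linear combinations of $e^{inx}$, $n\in\mathbb{Z}$, on $S^1=\mathbb{R}/2\pi\mathbb{Z}$. *)

theory Defs
  imports "HOL-Analysis.Analysis"
begin

section \<open>Operators in complex inner product spaces\<close>

text \<open>The inner product \<open>cinner\<close> is linear in the first and conjugate-linear in the second argument.
  Norm and topology are those of \<open>real_inner\<close>, whose inner product is \<open>Re (cinner x y)\<close>.
  Completeness is not required by any of the definitions below, so it is not part of the class.\<close>

class complex_inner = real_inner +
  fixes scaleC :: "complex \<Rightarrow> 'a \<Rightarrow> 'a"  (infixr \<open>*\<^sub>C\<close> 75)
    and cinner :: "'a \<Rightarrow> 'a \<Rightarrow> complex"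
  assumes scaleC_add_right: "a *\<^sub>C (x + y) = a *\<^sub>C x + a *\<^sub>C y"
    and scaleC_add_left: "(a + b) *\<^sub>C x = a *\<^sub>C x + b *\<^sub>C x"
    and scaleC_scaleC: "a *\<^sub>C (b *\<^sub>C x) = (a * b) *\<^sub>C x"
    and scaleC_of_real: "complex_of_real r *\<^sub>C x = r *\<^sub>R x"
    and cinner_add_left: "cinner (x + y) z = cinner x z + cinner y z"
    and cinner_scaleC_left: "cinner (a *\<^sub>C x) y = a * cinner x y"
    and cinner_commute: "cinner x y = cnj (cinner y x)"
    and Re_cinner: "Re (cinner x y) = inner x y"

text \<open>Unbounded operators are represented by their graphs, so that \<open>Domain\<close> is the domain, the closure
  of an operator is \<open>closure\<close> of its graph in the product topology, \<open>S\<inverse>\<close> is the inverse, and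
  the composition ``first \<open>S\<close>, then \<open>T\<close>'' is \<open>S O T\<close>.\<close>

type_synonym 'a graph = "('a \<times> 'a) set"

definition clinear_graph :: "'a::complex_inner graph \<Rightarrow> bool" where
  "clinear_graph D \<longleftrightarrow> (0, 0) \<in> D
     \<and> (\<forall>x y x' y'. (x, y) \<in> D \<longrightarrow> (x', y') \<in> D \<longrightarrow> (x + x', y + y') \<in> D)
     \<and> (\<forall>a x y. (x, y) \<in> D \<longrightarrow> (a *\<^sub>C x, a *\<^sub>C y) \<in> D)"

definition closed_densely_defined :: "'a::complex_inner graph \<Rightarrow> bool" where
  "closed_densely_defined D \<longleftrightarrow>
     clinear_graph D \<and> single_valued D \<and> closed D \<and> closure (Domain D) = UNIV"

definition adjoint_graph :: "'a::complex_inner graph \<Rightarrow> 'a graph" where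
  "adjoint_graph D = {(y, z). \<forall>(x, w) \<in> D. cinner w y = cinner x z}"

definition one_plus :: "'a::complex_inner graph \<Rightarrow> 'a graph" where
  "one_plus A = {(x, x + y) | x y. (x, y) \<in> A}"

definition bounded_clinear :: "('a::complex_inner \<Rightarrow> 'a) \<Rightarrow> bool" where
  "bounded_clinear T \<longleftrightarrow> bounded_linear T \<and> (\<forall>a x. T (a *\<^sub>C x) = a *\<^sub>C T x)"

definition positive_op :: "('a::complex_inner \<Rightarrow> 'a) \<Rightarrow> bool" where
  "positive_op T \<longleftrightarrow> (\<forall>x. cinner (T x) x \<in> \<real> \<and> 0 \<le> Re (cinner (T x) x))"

text \<open>\<open>T = A\<^bsup>-1/2\<^esup>\<close>: the inverse of \<open>A\<close> is everywhere defined and \<open>T\<close> is its bounded positive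
  square root. In a Hilbert space such a \<open>T\<close> is unique, and for \<open>A = 1 + D\<^sup>*D\<close> with \<open>D\<close> closed and
  densely defined it exists.\<close>

definition is_inverse_sqrt :: "'a::complex_inner graph \<Rightarrow> ('a \<Rightarrow> 'a) \<Rightarrow> bool" where
  "is_inverse_sqrt A T \<longleftrightarrow> bounded_clinear T \<and> positive_op T \<and> A\<inverse> = {(x, T (T x)) | x. True}"

definition compact_op :: "('a::complex_inner \<Rightarrow> 'a) \<Rightarrow> bool" where
  "compact_op T \<longleftrightarrow> bounded_clinear T \<and> compact (closure (T ` cball 0 1))"

text \<open>Since \<open>D O adjoint_graph D\<close> applies \<open>D\<close> first, it is the operator \<open>D\<^sup>*D\<close>; likewise
  \<open>adjoint_graph D O D\<close> is \<open>DD\<^sup>*\<close>.\<close>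

definition has_compact_parametrices :: "'a::complex_inner graph \<Rightarrow> bool" where
  "has_compact_parametrices D \<longleftrightarrow> closed_densely_defined D
     \<and> (\<exists>T. is_inverse_sqrt (one_plus (D O adjoint_graph D)) T \<and> compact_op T)
     \<and> (\<exists>T. is_inverse_sqrt (one_plus (adjoint_graph D O D)) T \<and> compact_op T)"

section \<open>The Hilbert space \<open>L\<^sup>2(S\<^sup>1)\<close>\<close>

text \<open>The circle \<open>\<real>/2\<pi>\<int>\<close> is represented by the fundamental domain \<open>[0, 2\<pi>]\<close> with Lebesgue
  measure; values of a function outside this interval are irrelevant.\<close>

abbreviation circle_measure :: "real measure" where
  "circle_measure \<equiv> lebesgue_on {0..2*pi}"

definition square_integrable :: "(real \<Rightarrow> complex) \<Rightarrow> bool" where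
  "square_integrable f \<longleftrightarrow> f \<in> borel_measurable circle_measure
     \<and> integrable circle_measure (\<lambda>x. (cmod (f x))\<^sup>2)"

definition l2_rel :: "(real \<Rightarrow> complex) \<Rightarrow> (real \<Rightarrow> complex) \<Rightarrow> bool" where
  "l2_rel f g \<longleftrightarrow> square_integrable f \<and> square_integrable g \<and> (AE x in circle_measure. f x = g x)"

lemma square_integrable_measurable [measurable_dest]:
  "square_integrable f \<Longrightarrow> f \<in> borel_measurable circle_measure"
  by (simp add: square_integrable_def)

lemma square_integrable_0: "square_integrable (\<lambda>x. 0)"
  by (simp add: square_integrable_def)

lemma square_integrable_add:
  assumes f: "square_integrable f" and g: "square_integrable g"
  shows "square_integrable (\<lambda>x. f x + g x)"
proof -
  have [measurable]: "f \<in> borel_measurable circle_measure" "g \<in> borel_measurable circle_measure"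
    using f g by (auto simp: square_integrable_def)
  have i: "integrable circle_measure (\<lambda>x. 2 * (cmod (f x))\<^sup>2 + 2 * (cmod (g x))\<^sup>2)"
    using f g by (auto simp: square_integrable_def)
  have le: "(cmod (f x + g x))\<^sup>2 \<le> 2 * (cmod (f x))\<^sup>2 + 2 * (cmod (g x))\<^sup>2" for x
  proof -
    have "(cmod (f x + g x))\<^sup>2 \<le> (cmod (f x) + cmod (g x))\<^sup>2"
      by (intro power_mono norm_triangle_ineq) auto
    also have "\<dots> \<le> 2 * (cmod (f x))\<^sup>2 + 2 * (cmod (g x))\<^sup>2"
      using sum_squares_bound[of "cmod (f x)" "cmod (g x)"] by (simp add: power2_sum)
    finally show ?thesis .
  qed
  show ?thesis
    unfolding square_integrable_def
  proof
    show "integrable circle_measure (\<lambda>x. (cmod (f x + g x))\<^sup>2)"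
      by (rule Bochner_Integration.integrable_bound[OF i]) (use le in \<open>auto intro!: AE_I2\<close>)
  qed auto
qed

lemma square_integrable_mult:
  assumes "square_integrable f"
  shows "square_integrable (\<lambda>x. a * f x)"
  using assms by (auto simp: square_integrable_def norm_mult power_mult_distrib)

lemma integrable_mult_cnj:
  assumes f: "square_integrable f" and g: "square_integrable g"
  shows "integrable circle_measure (\<lambda>x. f x * cnj (g x))"
proof -
  have [measurable]: "f \<in> borel_measurable circle_measure" "g \<in> borel_measurable circle_measure"
    using f g by (auto simp: square_integrable_def)
  have i: "integrable circle_measure (\<lambda>x. (cmod (f x))\<^sup>2 + (cmod (g x))\<^sup>2)"
    using f g by (auto simp: square_integrable_def)
  have "cmod (f x * cnj (g x)) \<le> (cmod (f x))\<^sup>2 + (cmod (g x))\<^sup>2" for x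
  proof -
    have "0 \<le> cmod (f x) * cmod (g x)"
      by simp
    with sum_squares_bound[of "cmod (f x)" "cmod (g x)"] show ?thesis
      unfolding norm_mult complex_mod_cnj mult.assoc by linarith
  qed
  moreover have "(\<lambda>x. f x * cnj (g x)) \<in> borel_measurable circle_measure"
  proof (rule borel_measurable_times)
    have "cnj \<in> borel_measurable borel"
      by (intro borel_measurable_continuous_onI continuous_intros)
    then show "(\<lambda>x. cnj (g x)) \<in> borel_measurable circle_measure"
      by measurable
  qed measurable
  ultimately show ?thesis
    by (intro Bochner_Integration.integrable_bound[OF i]) (auto intro!: AE_I2)
qed

quotient_type l2_circle = "real \<Rightarrow> complex" / partial: l2_rel
proof (rule part_equivpI)
  show "\<exists>x. l2_rel x x"
    using square_integrable_0 by (auto simp: l2_rel_def)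
  show "symp l2_rel"
    by (auto simp: symp_def l2_rel_def)
  show "transp l2_rel"
    unfolding transp_def l2_rel_def by (auto elim: AE_mp)
qed

instantiation l2_circle :: complex_inner
begin

lift_definition zero_l2_circle :: l2_circle is "\<lambda>x. 0"
  by (simp add: l2_rel_def square_integrable_0)

lift_definition plus_l2_circle :: "l2_circle \<Rightarrow> l2_circle \<Rightarrow> l2_circle" is "\<lambda>f g x. f x + g x"
  by (auto simp: l2_rel_def square_integrable_add)

lift_definition scaleC_l2_circle :: "complex \<Rightarrow> l2_circle \<Rightarrow> l2_circle" is "\<lambda>a f x. a * f x"
  by (auto simp: l2_rel_def square_integrable_mult)

lift_definition cinner_l2_circle :: "l2_circle \<Rightarrow> l2_circle \<Rightarrow> complex"
  is "\<lambda>f g. LINT x|circle_measure. f x * cnj (g x)"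
  unfolding l2_rel_def
  by (intro integral_cong_AE borel_measurable_integrable[OF integrable_mult_cnj]) auto

definition uminus_l2_circle :: "l2_circle \<Rightarrow> l2_circle" where
  "- f = (- 1) *\<^sub>C f" for f :: l2_circle

definition minus_l2_circle :: "l2_circle \<Rightarrow> l2_circle \<Rightarrow> l2_circle" where
  "f - g = f + (- g)" for f g :: l2_circle

definition scaleR_l2_circle :: "real \<Rightarrow> l2_circle \<Rightarrow> l2_circle" where
  "r *\<^sub>R f = complex_of_real r *\<^sub>C f" for f :: l2_circle

definition inner_l2_circle :: "l2_circle \<Rightarrow> l2_circle \<Rightarrow> real" where
  "inner f g = Re (cinner f g)" for f g :: l2_circle

definition norm_l2_circle :: "l2_circle \<Rightarrow> real" where
  "norm f = sqrt (inner f f)" for f :: l2_circle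

definition sgn_l2_circle :: "l2_circle \<Rightarrow> l2_circle" where
  "sgn f = inverse (norm f) *\<^sub>R f" for f :: l2_circle

definition dist_l2_circle :: "l2_circle \<Rightarrow> l2_circle \<Rightarrow> real" where
  "dist f g = norm (f - g)" for f g :: l2_circle

definition uniformity_l2_circle :: "(l2_circle \<times> l2_circle) filter" where
  "uniformity_l2_circle = (INF e\<in>{0<..}. principal {(x, y). dist x y < e})"

definition open_l2_circle :: "l2_circle set \<Rightarrow> bool" where
  "open_l2_circle U = (\<forall>x\<in>U. eventually (\<lambda>(x', y). x' = x \<longrightarrow> y \<in> U) uniformity)"

instance
proof
  fix f g h :: l2_circle and a b :: complex and r s :: real
  show add_assoc: "f + g + h = f + (g + h)"
    by transfer (auto simp: l2_rel_def square_integrable_add add.assoc)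
  show add_comm: "f + g = g + f"
    by transfer (auto simp: l2_rel_def square_integrable_add add.commute)
  show add_0: "0 + f = f"
    by transfer (auto simp: l2_rel_def)
  show "- f + f = 0"
    unfolding uminus_l2_circle_def
    by transfer (use square_integrable_add square_integrable_mult[of _ "-1"] in
        \<open>auto simp: l2_rel_def square_integrable_0\<close>)
  show "f - g = f + - g"
    by (simp add: minus_l2_circle_def)
  show Cr: "a *\<^sub>C (f + g) = a *\<^sub>C f + a *\<^sub>C g" for a and f g :: l2_circle
    by transfer (auto simp: l2_rel_def distrib_left
        intro!: square_integrable_add square_integrable_mult)
  show Cl: "(a + b) *\<^sub>C f = a *\<^sub>C f + b *\<^sub>C f" for a b and f :: l2_circle
    by transfer (auto simp: l2_rel_def distrib_right
        intro!: square_integrable_add square_integrable_mult)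
  show CC: "a *\<^sub>C b *\<^sub>C f = (a * b) *\<^sub>C f" for a b and f :: l2_circle
    by transfer (auto simp: l2_rel_def mult.assoc
        intro!: square_integrable_add square_integrable_mult)
  have C1: "1 *\<^sub>C f = f" for f :: l2_circle
    by transfer (auto simp: l2_rel_def)
  show "complex_of_real r *\<^sub>C f = r *\<^sub>R f"
    by (simp add: scaleR_l2_circle_def)
  show "r *\<^sub>R (f + g) = r *\<^sub>R f + r *\<^sub>R g"
    by (simp add: scaleR_l2_circle_def Cr)
  show "(r + s) *\<^sub>R f = r *\<^sub>R f + s *\<^sub>R f"
    by (simp add: scaleR_l2_circle_def Cl)
  show "r *\<^sub>R s *\<^sub>R f = (r * s) *\<^sub>R f"
    by (simp add: scaleR_l2_circle_def CC)
  show "1 *\<^sub>R f = f"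
    by (simp add: scaleR_l2_circle_def C1)
  show cadd: "cinner (f + g) h = cinner f h + cinner g h"
  proof transfer
    fix f g h :: "real \<Rightarrow> complex"
    assume "l2_rel f f" "l2_rel g g" "l2_rel h h"
    then show "(LINT x|circle_measure. (f x + g x) * cnj (h x)) =
        (LINT x|circle_measure. f x * cnj (h x)) + (LINT x|circle_measure. g x * cnj (h x))"
      using integrable_mult_cnj[of f h] integrable_mult_cnj[of g h]
      by (simp add: l2_rel_def distrib_right)
  qed
  show cscale: "cinner (a *\<^sub>C f) g = a * cinner f g" for a and f g :: l2_circle
    by transfer (simp add: mult.assoc)
  show ccomm: "cinner f g = cnj (cinner g f)"
    by transfer (simp flip: Bochner_Integration.integral_cnj, simp add: mult.commute)
  show "Re (cinner f g) = inner f g"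
    by (simp add: inner_l2_circle_def)
  show "sgn f = inverse (norm f) *\<^sub>R f"
    by (simp add: sgn_l2_circle_def)
  show "dist f g = norm (f - g)"
    by (simp add: dist_l2_circle_def)
  show "uniformity = (INF e\<in>{0<..}. principal {(x, y). dist (x::l2_circle) y < e})"
    by (simp add: uniformity_l2_circle_def)
  show "open U = (\<forall>x\<in>U. eventually (\<lambda>(x', y). x' = x \<longrightarrow> y \<in> U) uniformity)"
    for U :: "l2_circle set"
    by (simp add: open_l2_circle_def)
  show "inner f g = inner g f"
    using ccomm by (simp add: inner_l2_circle_def)
  show "inner (f + g) h = inner f h + inner g h"
    using cadd by (simp add: inner_l2_circle_def)
  show "inner (r *\<^sub>R f) g = r * inner f g"
    by (simp add: inner_l2_circle_def scaleR_l2_circle_def cscale)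
  have sq: "z * cnj z = complex_of_real ((cmod z)\<^sup>2)" for z
    by (rule complex_norm_square[symmetric])
  show "0 \<le> inner f f"
    unfolding inner_l2_circle_def
    by transfer (simp only: sq integral_complex_of_real Re_complex_of_real
        Bochner_Integration.integral_nonneg zero_le_power2)
  show "inner f f = 0 \<longleftrightarrow> f = 0"
    unfolding inner_l2_circle_def
  proof transfer
    fix f :: "real \<Rightarrow> complex"
    assume f: "l2_rel f f"
    then have "integrable circle_measure (\<lambda>x. (cmod (f x))\<^sup>2)"
      by (simp add: l2_rel_def square_integrable_def)
    then have "(LINT x|circle_measure. (cmod (f x))\<^sup>2) = 0 \<longleftrightarrow>
        (AE x in circle_measure. (cmod (f x))\<^sup>2 = 0)"
      by (intro integral_nonneg_eq_0_iff_AE) auto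
    then show "(Re (LINT x|circle_measure. f x * cnj (f x)) = 0) = l2_rel f (\<lambda>x. 0)"
      using f by (simp only: sq integral_complex_of_real Re_complex_of_real)
        (simp add: l2_rel_def square_integrable_0)
  qed
  show "norm f = sqrt (inner f f)"
    by (simp add: norm_l2_circle_def)
qed

end

section \<open>The operators on trigonometric polynomials\<close>

definition trig_poly :: "(real \<Rightarrow> complex) \<Rightarrow> bool" where
  "trig_poly p \<longleftrightarrow> (\<exists>(S :: int set) a. finite S \<and>
     p = (\<lambda>x. \<Sum>n\<in>S. a n * exp (\<i> * of_int n * complex_of_real x)))"

definition D_fun :: "complex \<Rightarrow> complex \<Rightarrow> (real \<Rightarrow> complex) \<Rightarrow> real \<Rightarrow> complex" where
  "D_fun b c p x = b * (1 / \<i> * vector_derivative p (at x)) + c * p x"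

definition D_tilde_fun :: "complex \<Rightarrow> complex \<Rightarrow> (real \<Rightarrow> complex) \<Rightarrow> real \<Rightarrow> complex" where
  "D_tilde_fun b c p x = exp (\<i> * complex_of_real x) * D_fun b c p x"

lemma square_integrable_continuous:
  assumes "continuous_on {0..2*pi} f"
  shows "square_integrable f"
  unfolding square_integrable_def
proof
  show "f \<in> borel_measurable circle_measure"
    using assms by (intro continuous_imp_measurable_on_sets_lebesgue) auto
  have "continuous_on {0..2*pi} (\<lambda>x. (cmod (f x))\<^sup>2)"
    by (intro continuous_intros assms)
  then show "integrable circle_measure (\<lambda>x. (cmod (f x))\<^sup>2)"
    by (rule continuous_imp_integrable_real)
qed

lemma trig_poly_vector_derivative:
  assumes "trig_poly p"
  shows "(p has_vector_derivative vector_derivative p (at x)) (at x)"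
    and "trig_poly (\<lambda>x. vector_derivative p (at x))"
proof -
  obtain S :: "int set" and a where S: "finite S"
    and p: "p = (\<lambda>x. \<Sum>n\<in>S. a n * exp (\<i> * of_int n * complex_of_real x))"
    using assms by (auto simp: trig_poly_def)
  have *: "(p has_vector_derivative
      (\<Sum>n\<in>S. a n * (\<i> * of_int n) * exp (\<i> * of_int n * complex_of_real x))) (at x)" for x
  proof -
    have "((\<lambda>z. \<Sum>n\<in>S. a n * exp (\<i> * of_int n * z)) has_field_derivative
        (\<Sum>n\<in>S. a n * (\<i> * of_int n) * exp (\<i> * of_int n * complex_of_real x))) (at (of_real x))"
      by (auto intro!: derivative_eq_intros sum.cong)
    from has_vector_derivative_real_field[OF this] show ?thesis
      by (simp add: p)
  qed
  then show "(p has_vector_derivative vector_derivative p (at x)) (at x)"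
    by (metis vector_derivative_at)
  have "(\<lambda>x. vector_derivative p (at x)) =
      (\<lambda>x. \<Sum>n\<in>S. (a n * (\<i> * of_int n)) * exp (\<i> * of_int n * complex_of_real x))"
    using * by (intro ext vector_derivative_at) auto
  then show "trig_poly (\<lambda>x. vector_derivative p (at x))"
    unfolding trig_poly_def using S
    by (intro exI[of _ S] exI[of _ "\<lambda>n. a n * (\<i> * of_int n)"]) auto
qed

text \<open>The equivalence classes taken in the graphs below are those of square-integrable functions.\<close>

lemma square_integrable_D:
  assumes "trig_poly p"
  shows "square_integrable p" "square_integrable (D_fun b c p)" "square_integrable (D_tilde_fun b c p)"
proof -
  have cont: "continuous_on {0..2*pi} q" if "trig_poly q" for q
    using that by (auto simp: trig_poly_def intro!: continuous_intros)
  note c = cont[OF assms] cont[OF trig_poly_vector_derivative(2)[OF assms]]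
  show "square_integrable p" "square_integrable (D_fun b c p)" "square_integrable (D_tilde_fun b c p)"
    unfolding D_fun_def D_tilde_fun_def
    by (intro square_integrable_continuous continuous_intros c)+
qed

definition D_op :: "complex \<Rightarrow> complex \<Rightarrow> l2_circle graph" where
  "D_op b c = closure {(abs_l2_circle p, abs_l2_circle (D_fun b c p)) | p. trig_poly p}"

definition D_tilde_op :: "complex \<Rightarrow> complex \<Rightarrow> l2_circle graph" where
  "D_tilde_op b c = closure {(abs_l2_circle p, abs_l2_circle (D_tilde_fun b c p)) | p. trig_poly p}"

end

theory Submission
  imports Defs
begin

text \<open>In the Fourier basis the two operators are weighted shifts, sending the \<open>n\<close>-th basis vector to
  \<open>b n + c\<close> times the \<open>n\<close>-th respectively \<open>(n + 1)\<close>-st one, where \<open>b\<close> is the limit in question. Then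
  \<open>(1 + D\<^sup>*D)\<^bsup>-1/2\<^esup>\<close> and \<open>(1 + DD\<^sup>*)\<^bsup>-1/2\<^esup>\<close> are diagonal with entries \<open>(1 + |b n + c|\<^sup>2)\<^bsup>-1/2\<^esup>\<close>, the latter
  up to an index shift. For \<open>b \<noteq> 0\<close> these entries are square summable and the operators are compact;
  for \<open>b = 0\<close> they are a constant nonzero multiple of the identity.
  Since the entries are square summable, all vectors that have to be constructed have absolutely
  summable Fourier coefficients, so they are continuous functions and the Riesz-Fischer theorem is
  not needed.\<close>

section \<open>Complex inner product spaces and weighted shifts\<close>

lemma cinner_add_right: "cinner x (y + z) = cinner x y + cinner x (z::'a::complex_inner)"
  by (metis cinner_add_left cinner_commute complex_cnj_add)

lemma cinner_scaleC_right: "cinner x (a *\<^sub>C y) = cnj a * cinner x (y::'a::complex_inner)"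
  by (metis cinner_scaleC_left cinner_commute complex_cnj_mult)

lemma cinner_self: "cinner x x = complex_of_real ((norm x)\<^sup>2)" for x :: "'a::complex_inner"
proof -
  have "Im (cinner x x) = 0"
    by (metis cinner_commute Reals_cnj_iff complex_is_Real_iff)
  then show ?thesis
    by (simp add: complex_eq_iff Re_cinner power2_norm_eq_inner)
qed

lemma norm_scaleC: "norm (a *\<^sub>C x) = cmod a * norm x" for x :: "'a::complex_inner"
proof -
  have "complex_of_real ((norm (a *\<^sub>C x))\<^sup>2) = complex_of_real ((cmod a * norm x)\<^sup>2)"
    by (simp add: cinner_self[symmetric] cinner_scaleC_left cinner_scaleC_right
        power_mult_distrib complex_norm_square del: of_real_power)
  then have "(norm (a *\<^sub>C x))\<^sup>2 = (cmod a * norm x)\<^sup>2"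
    using of_real_eq_iff by blast
  then show ?thesis
    by (rule power2_eq_imp_eq) auto
qed

text \<open>Rotating \<open>x\<close> by the conjugate phase \<open>u\<close> makes the inner
  product real and nonnegative, so the real Cauchy-Schwarz inequality applies. If the product
  vanishes, \<open>u\<close> is 0, and \<open>cmod u \<le> 1\<close> still holds.\<close>

lemma norm_cinner_le: "cmod (cinner x y) \<le> norm x * norm y" for x y :: "'a::complex_inner"
proof -
  define u where "u = cnj (sgn (cinner x y))"
  have "cmod (cinner x y) = Re (u * cinner x y)"
    by (cases "cinner x y = 0")
      (auto simp: u_def sgn_div_norm scaleR_conv_of_real mult.assoc
        mult.commute[of "cnj (cinner x y)"] complex_norm_square[symmetric] power2_eq_square
        simp flip: of_real_mult of_real_inverse)
  also have "\<dots> = inner (u *\<^sub>C x) y"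
    by (simp add: Re_cinner[symmetric] cinner_scaleC_left)
  also have "\<dots> \<le> norm (u *\<^sub>C x) * norm y"
    by (rule norm_cauchy_schwarz)
  also have "\<dots> = cmod u * (norm x * norm y)"
    by (simp add: norm_scaleC)
  also have "\<dots> \<le> 1 * (norm x * norm y)"
    by (rule mult_right_mono) (auto simp: u_def norm_sgn)
  finally show ?thesis by simp
qed

text \<open>Bounded real bilinearity supplies limits, continuity and finite sums of inner products
  through the interpretation below; complex homogeneity stays in separate rules.\<close>

lemma bounded_bilinear_cinner: "bounded_bilinear (cinner :: 'a::complex_inner \<Rightarrow> 'a \<Rightarrow> complex)"
proof
  fix x y z :: 'a and r :: real
  show "cinner (r *\<^sub>R x) y = r *\<^sub>R cinner x y"
    by (simp add: scaleC_of_real[symmetric] cinner_scaleC_left scaleR_conv_of_real)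
  show "cinner x (r *\<^sub>R y) = r *\<^sub>R cinner x y"
    by (simp add: scaleC_of_real[symmetric] cinner_scaleC_right scaleR_conv_of_real)
  show "\<exists>K. \<forall>x y::'a. norm (cinner x y) \<le> norm x * norm y * K"
    using norm_cinner_le by (intro exI[of _ 1]) auto
qed (rule cinner_add_left cinner_add_right)+

interpretation cinner: bounded_bilinear "cinner :: 'a::complex_inner \<Rightarrow> 'a \<Rightarrow> complex"
  by (rule bounded_bilinear_cinner)

lemma bounded_bilinear_scaleC: "bounded_bilinear (scaleC :: complex \<Rightarrow> 'a \<Rightarrow> 'a::complex_inner)"
proof
  fix x :: 'a and a :: complex and r :: real
  show "(r *\<^sub>R a) *\<^sub>C x = r *\<^sub>R (a *\<^sub>C x)"
    by (simp add: scaleC_of_real[symmetric] scaleC_scaleC scaleR_conv_of_real)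
  show "a *\<^sub>C (r *\<^sub>R x) = r *\<^sub>R (a *\<^sub>C x)"
    by (simp add: scaleC_of_real[symmetric] scaleC_scaleC mult.commute)
  show "\<exists>K. \<forall>a (x::'a). norm (a *\<^sub>C x) \<le> norm a * norm x * K"
    by (intro exI[of _ 1]) (simp add: norm_scaleC)
qed (rule scaleC_add_left scaleC_add_right)+

interpretation scaleC: bounded_bilinear "scaleC :: complex \<Rightarrow> 'a \<Rightarrow> 'a::complex_inner"
  by (rule bounded_bilinear_scaleC)

lemma scaleC_one: "1 *\<^sub>C x = x" for x :: "'a::complex_inner"
  using scaleC_of_real[of 1 x] by simp

section \<open>Orthonormal bases indexed by the integers and their Fourier expansions\<close>

lemma bij_int_add: "bij_betw (\<lambda>m::int. m + s) UNIV UNIV"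
  by (rule bij_betwI[where g = "\<lambda>m. m - s"]) auto

lemma bij_int_diff: "bij_betw (\<lambda>m::int. m - s) UNIV UNIV"
  using bij_int_add[of "- s"] by simp

text \<open>The assumption \<open>synthesis\<close> is a weak form of completeness, restricted to
  absolutely summable coefficient sequences; on the circle it comes from uniformly convergent
  Fourier series.\<close>

locale orthonormal_basis =
  fixes e :: "int \<Rightarrow> 'a::complex_inner"
  assumes cinner_basis: "\<And>m n. cinner (e m) (e n) = (if m = n then 1 else 0)"
    and dense: "closure {\<Sum>n\<in>S. a n *\<^sub>C e n | S a. finite S} = UNIV"
    and synthesis: "\<And>a. (\<lambda>n::int. cmod (a n)) summable_on UNIV \<Longrightarrow> \<exists>x. \<forall>n. cinner x (e n) = a n"
begin

definition coef :: "'a \<Rightarrow> int \<Rightarrow> complex" where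
  "coef x n = cinner x (e n)"

lemma coef_simps [simp]:
  "coef (x + y) n = coef x n + coef y n"
  "coef (x - y) n = coef x n - coef y n"
  "coef (a *\<^sub>C x) n = a * coef x n"
  "coef (r *\<^sub>R x) n = r *\<^sub>R coef x n"
  "coef 0 n = 0"
  "coef (e m) n = (if m = n then 1 else 0)"
  by (auto simp: coef_def cinner.add_left cinner.diff_left cinner_scaleC_left cinner.zero_left
      cinner_basis cinner.scaleR_left)

lemma coef_sum: "finite S \<Longrightarrow> coef (\<Sum>n\<in>S. a n *\<^sub>C e n) m = (if m \<in> S then a m else 0)"
  by (simp add: coef_def cinner.sum_left cinner_scaleC_left cinner_basis if_distrib cong: if_cong)

lemma norm_basis: "norm (e n) = 1"
proof -
  have "complex_of_real ((norm (e n))\<^sup>2) = complex_of_real 1"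
    unfolding cinner_self[symmetric] by (simp add: cinner_basis)
  then have "(norm (e n))\<^sup>2 = 1\<^sup>2"
    unfolding of_real_eq_iff by simp
  then show ?thesis
    by (rule power2_eq_imp_eq) auto
qed

lemma continuous_on_coef [continuous_intros]:
  "continuous_on S f \<Longrightarrow> continuous_on S (\<lambda>x. coef (f x) n)"
  unfolding coef_def by (intro cinner.continuous_on continuous_intros)

text \<open>Best approximation: the remainder after projecting onto the span of the
  \<open>e n\<close> with \<open>n \<in> F\<close> is orthogonal to that span, so by Pythagoras no
  other combination supported in \<open>F\<close> is closer to \<open>x\<close>.\<close>

lemma norm_diff_expansion_le:
  assumes F: "finite F" "S \<subseteq> F"
  shows "norm (x - (\<Sum>n\<in>F. coef x n *\<^sub>C e n)) \<le> norm (x - (\<Sum>n\<in>S. a n *\<^sub>C e n))"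
proof -
  define p where "p = (\<Sum>n\<in>F. coef x n *\<^sub>C e n)"
  define b where "b n = coef x n - (if n \<in> S then a n else 0)" for n
  define q where "q = (\<Sum>n\<in>F. b n *\<^sub>C e n)"
  have "(\<Sum>n\<in>S. a n *\<^sub>C e n) = (\<Sum>n\<in>F. (if n \<in> S then a n else 0) *\<^sub>C e n)"
    using F by (intro sum.mono_neutral_cong_left) (auto simp: scaleC.zero_left)
  then have "(\<Sum>n\<in>S. a n *\<^sub>C e n) = p - q"
    by (simp add: p_def q_def b_def sum_subtractf[symmetric] scaleC.diff_left[symmetric])
  moreover have "cinner (x - p) q = 0"
    unfolding q_def cinner.sum_right
  proof (intro sum.neutral ballI)
    fix n assume "n \<in> F"
    then have "coef (x - p) n = 0"
      using F by (simp add: p_def coef_sum)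
    then show "cinner (x - p) (b n *\<^sub>C e n) = 0"
      by (simp add: cinner_scaleC_right coef_def)
  qed
  then have "inner (x - p) q = 0"
    by (simp add: Re_cinner[symmetric])
  then have "(norm (x - p + q))\<^sup>2 = (norm (x - p))\<^sup>2 + (norm q)\<^sup>2"
    by (simp add: power2_norm_eq_inner inner_add_left inner_add_right inner_commute)
  then have "(norm (x - p))\<^sup>2 \<le> (norm (x - p + q))\<^sup>2"
    by (simp only: le_add_same_cancel1 zero_le_power2)
  moreover have "x - (p - q) = x - p + q"
    by simp
  ultimately have "(norm (x - p))\<^sup>2 \<le> (norm (x - (\<Sum>n\<in>S. a n *\<^sub>C e n)))\<^sup>2"
    by (simp only:)
  then show ?thesis
    unfolding p_def by (rule power2_le_imp_le) simp
qed

text \<open>Density gives one finite combination close to \<open>x\<close>, with support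
  \<open>S\<close>. By best approximation every partial sum over a finite set containing
  \<open>S\<close> is at least as close, which is convergence of the net.\<close>

lemma expansion: "((\<lambda>n. coef x n *\<^sub>C e n) has_sum x) UNIV"
  unfolding has_sum_def
proof (rule tendstoI)
  fix \<epsilon> :: real assume \<epsilon>: "0 < \<epsilon>"
  have "x \<in> closure {\<Sum>n\<in>S. a n *\<^sub>C e n | S a. finite S}"
    unfolding dense by simp
  then obtain S a where S: "finite S" "dist (\<Sum>n\<in>S. a n *\<^sub>C e n) x < \<epsilon>"
    using \<epsilon> unfolding closure_approachable by blast
  show "\<forall>\<^sub>F F in finite_subsets_at_top UNIV. dist (\<Sum>n\<in>F. coef x n *\<^sub>C e n) x < \<epsilon>"
    unfolding eventually_finite_subsets_at_top
  proof (intro exI[of _ S] conjI allI impI)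
    fix F assume "finite F \<and> S \<subseteq> F \<and> F \<subseteq> UNIV"
    then show "dist (\<Sum>n\<in>F. coef x n *\<^sub>C e n) x < \<epsilon>"
      using norm_diff_expansion_le[of F S x a] S(2) by (simp add: dist_norm norm_minus_commute)
  qed (use S in auto)
qed

lemma coef_eqI: "(\<And>n. coef x n = coef y n) \<Longrightarrow> x = y"
  using expansion[of x] expansion[of y] by (simp add: has_sum_unique)

lemma cinner_has_sum: "((\<lambda>n. coef x n * cnj (coef y n)) has_sum cinner x y) UNIV"
proof -
  have "((\<lambda>n. cinner (coef x n *\<^sub>C e n) y) has_sum cinner x y) UNIV"
    by (rule has_sum_bounded_linear[OF cinner.bounded_linear_left expansion])
  then show ?thesis
    by (simp add: cinner_scaleC_left coef_def cinner_commute[of "e _" y])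
qed

lemma parseval: "((\<lambda>n. (cmod (coef x n))\<^sup>2) has_sum (norm x)\<^sup>2) UNIV"
proof -
  have "((\<lambda>n. Re (coef x n * cnj (coef x n))) has_sum Re (cinner x x)) UNIV"
    by (rule has_sum_bounded_linear[OF bounded_linear_Re cinner_has_sum])
  then show ?thesis
    by (simp only: cinner_self complex_norm_square[symmetric] Re_complex_of_real)
qed

section \<open>Weighted shifts: closedness, cores and adjoints\<close>

definition weighted_shift :: "(int \<Rightarrow> complex) \<Rightarrow> int \<Rightarrow> 'a graph" where
  "weighted_shift d s = {(x, y). \<forall>n. coef y (n + s) = d n * coef x n}"

lemma basis_in_weighted_shift: "(e n, d n *\<^sub>C e (n + s)) \<in> weighted_shift d s"
  by (auto simp: weighted_shift_def)

lemma clinear_graph_weighted_shift: "clinear_graph (weighted_shift d s)"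
  by (auto simp: clinear_graph_def weighted_shift_def algebra_simps)

lemma weighted_shift_sum:
  assumes "finite S"
  shows "(\<Sum>n\<in>S. a n *\<^sub>C e n, \<Sum>n\<in>S. (a n * d n) *\<^sub>C e (n + s)) \<in> weighted_shift d s"
  using assms
proof (induction S rule: finite_induct)
  case (insert n S)
  have "(a n *\<^sub>C e n, (a n * d n) *\<^sub>C e (n + s)) \<in> weighted_shift d s"
    using basis_in_weighted_shift[of n d s] clinear_graph_weighted_shift[of d s]
    by (metis clinear_graph_def scaleC_scaleC)
  then show ?case
    using insert clinear_graph_weighted_shift[of d s] by (auto simp: clinear_graph_def)
qed (auto simp: weighted_shift_def)

text \<open>Each coefficient is a continuous functional, so the graph is an intersection of closed
  sets, one for each \<open>n\<close>.\<close>

lemma closed_weighted_shift: "closed (weighted_shift d s)"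
proof -
  have "weighted_shift d s = {p. \<forall>n. coef (snd p) (n + s) = d n * coef (fst p) n}"
    by (auto simp: weighted_shift_def)
  then show ?thesis
    by (auto intro!: closed_Collect_all closed_Collect_eq continuous_intros)
qed

text \<open>The graph on the left has the maximal domain. It is not larger than the closure because
  truncating the expansion of \<open>x\<close> truncates that of \<open>y\<close> as well, so both
  components converge along the same net.\<close>

lemma weighted_shift_eq_closure:
  "weighted_shift d s =
    closure {(\<Sum>n\<in>S. a n *\<^sub>C e n, \<Sum>n\<in>S. (a n * d n) *\<^sub>C e (n + s)) | S a. finite S}"
    (is "_ = closure ?G")
proof
  show "closure ?G \<subseteq> weighted_shift d s"
    by (rule closure_minimal[OF _ closed_weighted_shift]) (use weighted_shift_sum in blast)
  show "weighted_shift d s \<subseteq> closure ?G"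
  proof clarify
    fix x y assume xy: "(x, y) \<in> weighted_shift d s"
    \<comment> \<open>Reindexing by \<open>s\<close> lets the sums for \<open>x\<close> and
      \<open>y\<close> run over the same finite sets.\<close>
    have "((\<lambda>n. coef y (n + s) *\<^sub>C e (n + s)) has_sum y) UNIV"
      using expansion[of y] has_sum_reindex_bij_betw[of "\<lambda>n. n + s" UNIV UNIV "\<lambda>n. coef y n *\<^sub>C e n" y]
        bij_int_add[of s] by simp
    moreover have "coef y (n + s) = coef x n * d n" for n
      using xy by (simp add: weighted_shift_def mult.commute)
    ultimately have "((\<lambda>F. (\<Sum>n\<in>F. coef x n *\<^sub>C e n, \<Sum>n\<in>F. (coef x n * d n) *\<^sub>C e (n + s)))
        \<longlongrightarrow> (x, y)) (finite_subsets_at_top UNIV)"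
      using expansion[of x] unfolding has_sum_def by (intro tendsto_Pair) auto
    moreover have "\<forall>\<^sub>F F in finite_subsets_at_top UNIV.
        (\<Sum>n\<in>F. coef x n *\<^sub>C e n, \<Sum>n\<in>F. (coef x n * d n) *\<^sub>C e (n + s)) \<in> closure ?G"
      by (rule eventually_finite_subsets_at_top_weakI) (rule closure_subset[THEN subsetD], blast)
    ultimately show "(x, y) \<in> closure ?G"
      by (intro Lim_in_closed_set[OF closed_closure]) auto
  qed
qed

lemma closed_densely_defined_weighted_shift: "closed_densely_defined (weighted_shift d s)"
  unfolding closed_densely_defined_def
proof (intro conjI clinear_graph_weighted_shift closed_weighted_shift)
  show "single_valued (weighted_shift d s)"
  proof (rule single_valuedI)
    fix x y z assume *: "(x, y) \<in> weighted_shift d s" "(x, z) \<in> weighted_shift d s"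
    show "y = z"
    proof (rule coef_eqI)
      \<comment> \<open>Every index has the form \<open>(n - s) + s\<close>, so the defining
        equations fix all coefficients of the image.\<close>
      fix n show "coef y n = coef z n"
        using * by (auto simp: weighted_shift_def dest!: spec[of _ "n - s"])
    qed
  qed
  have "{\<Sum>n\<in>S. a n *\<^sub>C e n | S a. finite S} \<subseteq> Domain (weighted_shift d s)"
    using weighted_shift_sum by blast
  then show "closure (Domain (weighted_shift d s)) = UNIV"
    using closure_mono dense by blast
qed

text \<open>Testing the adjoint relation on basis vectors determines each coefficient of
  \<open>z\<close>. Conversely, those coefficient equations make the Parseval series of the two
  inner products agree term by term, once one of them is reindexed by \<open>s\<close>.\<close>

lemma adjoint_weighted_shift:
  "adjoint_graph (weighted_shift d s) = weighted_shift (\<lambda>n. cnj (d (n - s))) (- s)"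
proof -
  have "(y, z) \<in> adjoint_graph (weighted_shift d s) \<longleftrightarrow> (\<forall>n. coef z n = cnj (d n) * coef y (n + s))" for y z
  proof
    assume *: "(y, z) \<in> adjoint_graph (weighted_shift d s)"
    show "\<forall>n. coef z n = cnj (d n) * coef y (n + s)"
    proof
      fix n
      have "cinner (d n *\<^sub>C e (n + s)) y = cinner (e n) z"
        using * basis_in_weighted_shift[of n d s] by (auto simp: adjoint_graph_def)
      then have "cnj (d n * cinner (e (n + s)) y) = cnj (cinner (e n) z)"
        by (simp add: cinner_scaleC_left)
      then show "coef z n = cnj (d n) * coef y (n + s)"
        by (simp add: coef_def cinner_commute[symmetric])
    qed
  next
    assume z: "\<forall>n. coef z n = cnj (d n) * coef y (n + s)"
    have "cinner w y = cinner x z" if xw: "(x, w) \<in> weighted_shift d s" for x w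
    proof -
      have "((\<lambda>n. coef w (n + s) * cnj (coef y (n + s))) has_sum cinner w y) UNIV"
        using cinner_has_sum[of w y] bij_int_add[of s]
          has_sum_reindex_bij_betw[of "\<lambda>n. n + s" UNIV UNIV "\<lambda>n. coef w n * cnj (coef y n)"]
        by simp
      moreover have "coef w (n + s) * cnj (coef y (n + s)) = coef x n * cnj (coef z n)" for n
        using xw z by (simp add: weighted_shift_def)
      ultimately show ?thesis
        using cinner_has_sum[of x z] has_sum_unique by simp blast
    qed
    then show "(y, z) \<in> adjoint_graph (weighted_shift d s)"
      by (auto simp: adjoint_graph_def)
  qed
  \<comment> \<open>The substitution \<open>m = n + s\<close> brings the relation into the form of a
    shift by \<open>- s\<close>.\<close>
  moreover have "(\<forall>n. coef z n = cnj (d n) * coef y (n + s)) \<longleftrightarrow>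
      (\<forall>m. coef z (m - s) = cnj (d (m - s)) * coef y m)" for y z
    by (metis add_diff_cancel_right' diff_add_cancel)
  ultimately show ?thesis
    by (auto simp: weighted_shift_def)
qed

text \<open>The two conjugations and the two index shifts cancel. This makes results on D*D, applied
  to the adjoint, into results on DD*.\<close>

lemma adjoint_adjoint_weighted_shift:
  "adjoint_graph (adjoint_graph (weighted_shift d s)) = weighted_shift d s"
  by (simp add: adjoint_weighted_shift)

text \<open>The product of two square summable sequences is absolutely summable, so
  \<open>synthesis\<close> realises it.\<close>

lemma synthesis_mult:
  fixes t :: "int \<Rightarrow> real" and a :: "int \<Rightarrow> complex"
  assumes "(\<lambda>n. (t n)\<^sup>2) summable_on UNIV" "(\<lambda>n. (cmod (a n))\<^sup>2) summable_on UNIV"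
  shows "\<exists>x. \<forall>n. coef x n = t n * a n"
  unfolding coef_def
  by (rule synthesis, rule abs_summable_product)
    (use assms in \<open>auto simp: norm_mult power2_eq_square abs_mult_self_eq\<close>)

section \<open>Compact positive diagonal operators with square summable entries\<close>

definition diag :: "(int \<Rightarrow> real) \<Rightarrow> 'a \<Rightarrow> 'a" where
  "diag t x = (SOME y. \<forall>n. coef y n = t n * coef x n)"

context
  fixes t :: "int \<Rightarrow> real"
  assumes t0: "\<And>n. 0 \<le> t n" and t1: "\<And>n. t n \<le> 1" and t2: "(\<lambda>n. (t n)\<^sup>2) summable_on UNIV"
begin

text \<open>The vector chosen in \<open>diag\<close> exists by \<open>synthesis_mult\<close>: the
  entries \<open>t\<close> are square summable by assumption, the coefficients of \<open>x\<close>
  by Parseval.\<close>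

lemma coef_diag: "coef (diag t x) n = t n * coef x n"
  using someI_ex[OF synthesis_mult[OF t2 has_sum_imp_summable[OF parseval[of x]]]]
  unfolding diag_def by blast

lemma norm_diag_le: "norm (diag t x) \<le> norm x"
proof -
  have "(norm (diag t x))\<^sup>2 \<le> (norm x)\<^sup>2"
  proof (rule has_sum_mono[OF parseval parseval])
    fix n
    show "(cmod (coef (diag t x) n))\<^sup>2 \<le> (cmod (coef x n))\<^sup>2"
      using t0[of n] t1[of n] by (intro power_mono) (auto simp: coef_diag norm_mult mult_left_le_one_le)
  qed
  then show ?thesis
    by (rule power2_le_imp_le) simp
qed

lemma bounded_clinear_diag: "bounded_clinear (diag t)"
  unfolding bounded_clinear_def
proof
  show "bounded_linear (diag t)"
  proof (rule bounded_linear_intro[where K = 1])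
    show "norm (diag t x) \<le> norm x * 1" for x
      by (simp add: norm_diag_le)
  qed (auto intro!: coef_eqI simp: coef_diag algebra_simps)
qed (auto intro!: coef_eqI simp: coef_diag algebra_simps)

lemma positive_op_diag: "positive_op (diag t)"
  unfolding positive_op_def
proof
  fix x
  have "((\<lambda>n. coef (diag t x) n * cnj (coef x n)) has_sum cinner (diag t x) x) UNIV"
    by (rule cinner_has_sum)
  then have *: "((\<lambda>n. complex_of_real (t n * (cmod (coef x n))\<^sup>2)) has_sum cinner (diag t x) x) UNIV"
    by (simp add: coef_diag mult.assoc complex_norm_square[symmetric] del: of_real_power)
  have "((\<lambda>n. t n * (cmod (coef x n))\<^sup>2) has_sum Re (cinner (diag t x) x)) UNIV"
    using has_sum_bounded_linear[OF bounded_linear_Re *] by simp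
  moreover from this have "0 \<le> Re (cinner (diag t x) x)"
    by (rule has_sum_nonneg) (simp add: t0)
  moreover have "((\<lambda>n::int. 0) has_sum Im (cinner (diag t x) x)) UNIV"
    using has_sum_bounded_linear[OF bounded_linear_Im *] unfolding Im_complex_of_real .
  then have "Im (cinner (diag t x) x) = 0"
    by (metis has_sum_0 has_sum_unique)
  ultimately show "cinner (diag t x) x \<in> \<real> \<and> 0 \<le> Re (cinner (diag t x) x)"
    by (simp add: complex_is_Real_iff)
qed

text \<open>The image of the unit ball lies in a continuous image of a closed subset of the product of
  closed unit discs, which is compact by Tychonoff's theorem. Working with coefficient sequences
  avoids the completeness of the space.\<close>

lemma compact_op_diag: "compact_op (diag t)"
proof -
  \<comment> \<open>\<open>K\<close> is the unit ball of the square summable sequences. Stated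
    through finite sums, each condition involves finitely many coordinates, so \<open>K\<close> is
    closed in the product topology.\<close>
  define K where "K = {a :: int \<Rightarrow> complex. \<forall>F. finite F \<longrightarrow> (\<Sum>n\<in>F. (cmod (a n))\<^sup>2) \<le> 1}"
  define \<Phi> where "\<Phi> a = (SOME x. \<forall>n. coef x n = t n * a n)" for a :: "int \<Rightarrow> complex"
  have K1: "cmod (a n) \<le> 1" if "a \<in> K" for a :: "int \<Rightarrow> complex" and n
  proof -
    have "(\<Sum>n\<in>{n}. (cmod (a n))\<^sup>2) \<le> 1"
      using that unfolding K_def by blast
    then show ?thesis
      by (simp add: abs_square_le_1)
  qed
  have \<Phi>: "coef (\<Phi> a) n = t n * a n" if "a \<in> K" for a :: "int \<Rightarrow> complex" and n
  proof -
    have "(\<lambda>n. (cmod (a n))\<^sup>2) summable_on UNIV"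
      using that by (intro nonneg_bdd_above_summable_on bdd_aboveI[of _ 1]) (auto simp: K_def)
    from someI_ex[OF synthesis_mult[OF t2 this]] show ?thesis
      unfolding \<Phi>_def by blast
  qed
  have "compactin (product_topology (\<lambda>_. euclidean) UNIV) (PiE UNIV (\<lambda>_::int. cball (0::complex) 1))"
    by (simp add: compactin_PiE)
  then have "compact (PiE UNIV (\<lambda>_::int. cball (0::complex) 1))"
    by (simp add: euclidean_product_topology)
  moreover have "closed K"
    unfolding K_def
    by (intro closed_Collect_all closed_Collect_imp open_Collect_const closed_Collect_le
        continuous_intros continuous_on_product_coordinates)
  ultimately have "compact (PiE UNIV (\<lambda>_::int. cball (0::complex) 1) \<inter> K)"
    by (rule compact_Int_closed)
  moreover have "PiE UNIV (\<lambda>_::int. cball (0::complex) 1) \<inter> K = K"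
    using K1 by (auto simp: PiE_def)
  ultimately have "compact K"
    by simp
  \<comment> \<open>Finite partial sums depend continuously on finitely many coordinates. They
    converge uniformly on \<open>K\<close>, because \<open>cmod (a n) \<le> 1\<close> bounds the
    squared norm of the remainder by the tail of the series of \<open>(t n)\<^sup>2\<close>.\<close>
  moreover have "continuous_on K \<Phi>"
  proof (rule uniform_limit_theorem)
    show "\<forall>\<^sub>F F in finite_subsets_at_top UNIV. continuous_on K (\<lambda>a::int \<Rightarrow> complex. \<Sum>n\<in>F. (t n * a n) *\<^sub>C e n)"
      by (intro always_eventually allI continuous_on_sum scaleC.continuous_on continuous_intros
          continuous_on_subset[OF continuous_on_product_coordinates]) auto
    show "uniform_limit K (\<lambda>F (a::int \<Rightarrow> complex). \<Sum>n\<in>F. (t n * a n) *\<^sub>C e n) \<Phi> (finite_subsets_at_top UNIV)"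
    proof (rule uniform_limitI)
      fix \<epsilon> :: real assume \<epsilon>: "0 < \<epsilon>"
      define s where "s = (\<Sum>\<^sub>\<infinity>n. (t n)\<^sup>2)"
      have s: "((\<lambda>n. (t n)\<^sup>2) has_sum s) UNIV"
        using t2 by (simp add: s_def)
      then have "\<forall>\<^sub>F F in finite_subsets_at_top UNIV. dist (\<Sum>n\<in>F. (t n)\<^sup>2) s < \<epsilon>\<^sup>2"
        unfolding has_sum_def using \<epsilon> by (intro tendstoD) auto
      moreover have "\<forall>\<^sub>F F in finite_subsets_at_top UNIV. finite (F :: int set)"
        by (rule eventually_finite_subsets_at_top_weakI)
      ultimately show "\<forall>\<^sub>F F in finite_subsets_at_top UNIV.
          \<forall>a\<in>K. dist (\<Sum>n\<in>F. (t n * a n) *\<^sub>C e n) (\<Phi> a) < \<epsilon>"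
      proof eventually_elim
        case (elim F)
        show ?case
        proof
          fix a :: "int \<Rightarrow> complex" assume a: "a \<in> K"
          define x where "x = \<Phi> a - (\<Sum>n\<in>F. (t n * a n) *\<^sub>C e n)"
          have "((\<lambda>n. (if n \<in> F then (t n)\<^sup>2 else 0)) has_sum (\<Sum>n\<in>F. (t n)\<^sup>2)) UNIV"
            by (rule has_sum_finite_neutralI) (use elim in auto)
          with s have "((\<lambda>n. (t n)\<^sup>2 + - (if n \<in> F then (t n)\<^sup>2 else 0)) has_sum
              (s + - (\<Sum>n\<in>F. (t n)\<^sup>2))) UNIV"
            by (intro has_sum_add) (auto simp: has_sum_uminus)
          then have "(norm x)\<^sup>2 \<le> s + - (\<Sum>n\<in>F. (t n)\<^sup>2)"
          proof (rule has_sum_mono[OF parseval])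
            fix n
            have "(t n)\<^sup>2 * (cmod (a n))\<^sup>2 \<le> (t n)\<^sup>2"
              using K1[OF a, of n] by (intro mult_left_le) (auto simp: power_le_one)
            then show "(cmod (coef x n))\<^sup>2 \<le> (t n)\<^sup>2 + - (if n \<in> F then (t n)\<^sup>2 else 0)"
              using elim by (auto simp: x_def coef_sum \<Phi>[OF a] norm_mult power_mult_distrib)
          qed
          also have "\<dots> < \<epsilon>\<^sup>2"
            using elim by (simp add: dist_real_def)
          finally have "norm x < \<epsilon>"
            by (rule power2_less_imp_less) (use \<epsilon> in simp)
          then show "dist (\<Sum>n\<in>F. (t n * a n) *\<^sub>C e n) (\<Phi> a) < \<epsilon>"
            by (simp add: dist_norm norm_minus_commute x_def)
        qed
      qed
    qed
  qed simp
  ultimately have compact: "compact (\<Phi> ` K)"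
    by (intro compact_continuous_image)
  have "diag t ` cball 0 1 \<subseteq> \<Phi> ` K"
  proof clarify
    fix x :: 'a assume x: "x \<in> cball 0 1"
    have K: "coef x \<in> K"
      unfolding K_def
    proof clarify
      fix F :: "int set" assume "finite F"
      then have "(\<Sum>n\<in>F. (cmod (coef x n))\<^sup>2) \<le> (norm x)\<^sup>2"
        by (intro has_sum_mono_neutral[OF has_sum_finite parseval]) auto
      also have "\<dots> \<le> 1"
        using x by (simp add: power_le_one)
      finally show "(\<Sum>n\<in>F. (cmod (coef x n))\<^sup>2) \<le> 1" .
    qed
    have "diag t x = \<Phi> (coef x)"
      by (rule coef_eqI) (simp add: coef_diag \<Phi>[OF K])
    then show "diag t x \<in> \<Phi> ` K"
      using K by blast
  qed
  then have "closure (diag t ` cball 0 1) \<subseteq> \<Phi> ` K"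
    by (intro closure_minimal compact_imp_closed compact)
  then have "compact (closure (diag t ` cball 0 1))"
    using compact_Int_closed[OF compact closed_closure] by (metis inf.absorb2)
  then show ?thesis
    by (simp add: compact_op_def bounded_clinear_diag)
qed

end

section \<open>Weighted shifts with and without compact parametrices\<close>

lemma weighted_shift_inverse_sqrt:
  assumes sum: "(\<lambda>n. 1 / (1 + (cmod (d n))\<^sup>2)) summable_on UNIV"
  shows "\<exists>T. is_inverse_sqrt (one_plus (weighted_shift d s O adjoint_graph (weighted_shift d s))) T
    \<and> compact_op T"
proof -
  \<comment> \<open>The index shift cancels in D*D, which is diagonal with entries
    \<open>(cmod (d n))\<^sup>2\<close>; hence \<open>t\<close> gives the entries of the inverse
    square root of 1 + D*D.\<close>
  define t where "t n = 1 / sqrt (1 + (cmod (d n))\<^sup>2)" for n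
  have pos: "0 < 1 + (cmod (d n))\<^sup>2" for n
    by (simp add: add_pos_nonneg)
  have t_sq: "(t n)\<^sup>2 = 1 / (1 + (cmod (d n))\<^sup>2)" for n
    using pos[of n] by (simp add: t_def power_divide)
  have t0: "0 \<le> t n" for n
    using pos[of n] by (simp add: t_def)
  have t1: "t n \<le> 1" for n
    using pos[of n] by (simp add: t_def)
  have t2: "(\<lambda>n. (t n)\<^sup>2) summable_on UNIV"
    using sum by (simp add: t_sq)
  note coef = coef_diag[OF t0 t1 t2]
  have c2: "coef (diag t (diag t x)) n * complex_of_real (1 + (cmod (d n))\<^sup>2) = coef x n" for x n
  proof -
    have "t n * t n * (1 + (cmod (d n))\<^sup>2) = 1"
      using pos[of n] t_sq[of n] by (simp add: power2_eq_square)
    then have "complex_of_real (t n * t n * (1 + (cmod (d n))\<^sup>2)) * coef x n = coef x n"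
      by (simp only: of_real_1 mult_1)
    then show ?thesis
      by (simp add: coef algebra_simps)
  qed
  have graph: "(u, x) \<in> one_plus (weighted_shift d s O adjoint_graph (weighted_shift d s))
      \<longleftrightarrow> u = diag t (diag t x)" for u x
  proof
    assume "(u, x) \<in> one_plus (weighted_shift d s O adjoint_graph (weighted_shift d s))"
    then obtain y v where y: "(u, y) \<in> weighted_shift d s"
      and v: "(y, v) \<in> adjoint_graph (weighted_shift d s)" and x: "x = u + v"
      by (auto simp: one_plus_def)
    show "u = diag t (diag t x)"
    proof (rule coef_eqI)
      fix n
      have "coef v n = cnj (d n) * coef y (n + s)"
        using v unfolding adjoint_weighted_shift by (auto simp: weighted_shift_def dest: spec[of _ "n + s"])
      also have "coef y (n + s) = d n * coef u n"
        using y by (simp add: weighted_shift_def)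
      finally have "coef x n = coef u n * complex_of_real (1 + (cmod (d n))\<^sup>2)"
        by (simp add: x algebra_simps complex_norm_square[symmetric] del: of_real_power)
      then have "coef u n * complex_of_real (1 + (cmod (d n))\<^sup>2) = coef (diag t (diag t x)) n * complex_of_real (1 + (cmod (d n))\<^sup>2)"
        using c2 by simp
      moreover have "complex_of_real (1 + (cmod (d n))\<^sup>2) \<noteq> 0"
        using pos[of n] unfolding of_real_eq_0_iff by simp
      ultimately show "coef u n = coef (diag t (diag t x)) n"
        by (simp only: mult_cancel_right) simp
    qed
  next
    assume u: "u = diag t (diag t x)"
    \<comment> \<open>The intermediate vector \<open>y\<close> is to be the image of
      \<open>u\<close>. One factor \<open>t\<close> is split off its coefficients; what remains is
      square summable, since \<open>cmod (d n) * t n \<le> 1\<close>.\<close>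
    define a where "a m = d (m - s) * t (m - s) * coef x (m - s)" for m
    have "\<exists>y. \<forall>m. coef y m = t (m - s) * a m"
    proof (rule synthesis_mult)
      show "(\<lambda>m. (t (m - s))\<^sup>2) summable_on UNIV"
        using summable_on_reindex_bij_betw[OF bij_int_diff, of "\<lambda>m. (t m)\<^sup>2"] t2 by simp
      have "(\<lambda>m. (cmod (coef x (m - s)))\<^sup>2) summable_on UNIV"
        using summable_on_reindex_bij_betw[OF bij_int_diff, of "\<lambda>m. (cmod (coef x m))\<^sup>2"]
          has_sum_imp_summable[OF parseval[of x]] by simp
      then show "(\<lambda>m. (cmod (a m))\<^sup>2) summable_on UNIV"
      proof (rule summable_on_comparison_test)
        fix m
        have "(cmod (d (m - s)))\<^sup>2 * (t (m - s))\<^sup>2 \<le> 1"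
          using pos[of "m - s"] by (simp add: t_sq)
        then show "(cmod (a m))\<^sup>2 \<le> (cmod (coef x (m - s)))\<^sup>2"
          by (simp add: a_def norm_mult power_mult_distrib mult_left_le_one_le)
      qed simp
    qed
    then obtain y where y: "coef y m = t (m - s) * a m" for m
      by blast
    have "(u, y) \<in> weighted_shift d s"
      by (simp add: weighted_shift_def y u coef a_def)
    moreover have "(y, x - u) \<in> adjoint_graph (weighted_shift d s)"
      unfolding adjoint_weighted_shift
      unfolding weighted_shift_def
    proof clarsimp
      fix n
      have "coef x (n - s) = coef u (n - s) * complex_of_real (1 + (cmod (d (n - s)))\<^sup>2)"
        unfolding u c2 ..
      also have "complex_of_real (1 + (cmod (d (n - s)))\<^sup>2) = 1 + d (n - s) * cnj (d (n - s))"
        by (simp only: of_real_add of_real_1 complex_norm_square)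
      finally have "coef x (n - s) - coef u (n - s) = coef u (n - s) * (d (n - s) * cnj (d (n - s)))"
        by (simp add: distrib_left)
      also have "\<dots> = cnj (d (n - s)) * coef y n"
        by (simp add: y a_def u coef)
      finally show "coef x (n - s) - coef u (n - s) = cnj (d (n - s)) * coef y n" .
    qed
    ultimately show "(u, x) \<in> one_plus (weighted_shift d s O adjoint_graph (weighted_shift d s))"
      by (force simp: one_plus_def)
  qed
  have "is_inverse_sqrt (one_plus (weighted_shift d s O adjoint_graph (weighted_shift d s))) (diag t)"
    unfolding is_inverse_sqrt_def
    using bounded_clinear_diag[OF t0 t1 t2] positive_op_diag[OF t0 t1 t2] graph by auto
  then show ?thesis
    using compact_op_diag[OF t0 t1 t2] by blast
qed

text \<open>The condition on DD* is the condition on D*D for the adjoint. The weights of the adjoint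
  are conjugated and shifted, which preserves summability.\<close>

lemma weighted_shift_compact_parametrices:
  assumes sum: "(\<lambda>n. 1 / (1 + (cmod (d n))\<^sup>2)) summable_on UNIV"
  shows "has_compact_parametrices (weighted_shift d s)"
proof -
  define d' where "d' n = cnj (d (n - s))" for n
  have adj: "adjoint_graph (weighted_shift d s) = weighted_shift d' (- s)"
    by (simp add: adjoint_weighted_shift d'_def[abs_def])
  from summable_on_reindex_bij_betw[OF bij_int_diff, of "\<lambda>n. 1 / (1 + (cmod (d n))\<^sup>2)"] sum
  have "(\<lambda>n. 1 / (1 + (cmod (d' n))\<^sup>2)) summable_on UNIV"
    by (simp add: d'_def)
  from weighted_shift_inverse_sqrt[OF this, of "- s"]
  have "\<exists>T. is_inverse_sqrt (one_plus (adjoint_graph (weighted_shift d s) O weighted_shift d s)) T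
      \<and> compact_op T"
    unfolding adj[symmetric] adjoint_adjoint_weighted_shift .
  then show ?thesis
    unfolding has_compact_parametrices_def
    using closed_densely_defined_weighted_shift weighted_shift_inverse_sqrt[OF sum] by blast
qed

lemma dist_basis: "m \<noteq> n \<Longrightarrow> dist (e m) (e n) = sqrt 2"
proof -
  assume "m \<noteq> n"
  then have "cinner (e m - e n) (e m - e n) = 2"
    by (simp add: cinner.diff_left cinner.diff_right cinner_basis)
  then have "(norm (e m - e n))\<^sup>2 = 2"
    unfolding cinner_self by (metis of_real_eq_iff of_real_numeral)
  then show ?thesis
    by (metis dist_norm norm_ge_zero real_sqrt_unique)
qed

text \<open>On every basis vector 1 + D*D is multiplication by the same constant \<open>k\<close>,
  so \<open>e n\<close> is recovered as \<open>k\<close> times \<open>T (T (e n))\<close>. If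
  \<open>T\<close> were compact, the basis would have a convergent subsequence, which the mutual
  distance \<open>sqrt 2\<close> forbids.\<close>

lemma constant_weight_not_compact_parametrices:
  "\<not> has_compact_parametrices (weighted_shift (\<lambda>_. c) s)"
proof
  define W where "W = weighted_shift (\<lambda>_. c) s"
  define k where "k = complex_of_real (1 + (cmod c)\<^sup>2)"
  assume "has_compact_parametrices (weighted_shift (\<lambda>_. c) s)"
  then obtain T where T: "is_inverse_sqrt (one_plus (W O adjoint_graph W)) T" "compact_op T"
    by (auto simp: has_compact_parametrices_def W_def)
  have bl: "bounded_linear T" and Tc: "T (a *\<^sub>C x) = a *\<^sub>C T x" for a x
    using T(2) by (auto simp: compact_op_def bounded_clinear_def)
  have TT: "k *\<^sub>C T (T (e n)) = e n" for n
  proof -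
    have "(e n, c *\<^sub>C e (n + s)) \<in> W"
      unfolding W_def using basis_in_weighted_shift[of n "\<lambda>_. c"] by simp
    moreover have "(c *\<^sub>C e (n + s), (c * cnj c) *\<^sub>C e n) \<in> adjoint_graph W"
      unfolding W_def adjoint_weighted_shift by (auto simp: weighted_shift_def)
    ultimately have "(e n, e n + (c * cnj c) *\<^sub>C e n) \<in> one_plus (W O adjoint_graph W)"
      by (auto simp: one_plus_def)
    moreover have "e n + (c * cnj c) *\<^sub>C e n = k *\<^sub>C e n"
      by (simp add: k_def complex_norm_square[symmetric] scaleC_add_left scaleC_one)
    ultimately have "(k *\<^sub>C e n, e n) \<in> {(x, T (T x)) |x. True}"
      using T(1) unfolding is_inverse_sqrt_def by (metis converse_iff)
    then show ?thesis
      by (simp add: Tc)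
  qed
  have mem: "T (e (int n)) \<in> closure (T ` cball 0 1)" for n
    by (rule closure_subset[THEN subsetD]) (auto simp: norm_basis)
  have sc: "seq_compact (closure (T ` cball 0 1))"
    using T(2) by (simp add: compact_op_def compact_imp_seq_compact)
  obtain l r where r: "strict_mono (r :: nat \<Rightarrow> nat)"
    and lim: "((\<lambda>n. T (e (int n))) \<circ> r) \<longlonglongrightarrow> l"
    using seq_compactE[OF sc, of "\<lambda>n. T (e (int n))"] mem by blast
  have "(\<lambda>n. k *\<^sub>C T (T (e (int (r n))))) \<longlonglongrightarrow> k *\<^sub>C T l"
    using lim by (intro scaleC.tendsto tendsto_const bounded_linear.tendsto[OF bl]) (simp add: o_def)
  then have lim: "(\<lambda>n. e (int (r n))) \<longlonglongrightarrow> k *\<^sub>C T l"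
    by (simp add: TT)
  \<comment> \<open>Successive terms of a convergent sequence approach each other, while here their
    distance is constant.\<close>
  have "(\<lambda>n. dist (e (int (r (Suc n)))) (e (int (r n)))) \<longlonglongrightarrow> dist (k *\<^sub>C T l) (k *\<^sub>C T l)"
    by (intro tendsto_dist lim LIMSEQ_Suc[OF lim])
  moreover have "r (Suc n) \<noteq> r n" for n
    using r by (simp add: strict_mono_eq)
  ultimately show False
    by (simp add: dist_basis LIMSEQ_const_iff)
qed

end

section \<open>Density of the trigonometric polynomials\<close>

lemma l2_rel_refl: "square_integrable f \<Longrightarrow> l2_rel f f"
  by (simp add: l2_rel_def)

lemma l2_circle_cases:
  obtains f where "square_integrable f" "x = abs_l2_circle f"
  using l2_circle.abs_induct[of "\<lambda>x. \<exists>f. square_integrable f \<and> x = abs_l2_circle f" x]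
  by (auto simp: l2_rel_def)

lemma abs_l2_circle_add:
  assumes "square_integrable f" "square_integrable g"
  shows "abs_l2_circle (\<lambda>x. f x + g x) = abs_l2_circle f + abs_l2_circle g"
  using assms by (simp add: plus_l2_circle.abs_eq l2_rel_refl)

lemma abs_l2_circle_mult:
  assumes "square_integrable f"
  shows "abs_l2_circle (\<lambda>x. a * f x) = a *\<^sub>C abs_l2_circle f"
  using assms by (simp add: scaleC_l2_circle.abs_eq l2_rel_refl)

lemma square_integrable_diff:
  assumes "square_integrable f" "square_integrable g"
  shows "square_integrable (\<lambda>x. f x - g x)"
  using square_integrable_add[OF assms(1) square_integrable_mult[OF assms(2), of "-1"]] by simp

lemma abs_l2_circle_diff:
  assumes "square_integrable f" "square_integrable g"
  shows "abs_l2_circle (\<lambda>x. f x - g x) = abs_l2_circle f - abs_l2_circle g"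
  using abs_l2_circle_add[OF assms(1) square_integrable_mult[OF assms(2), of "-1"]]
    abs_l2_circle_mult[OF assms(2), of "-1"]
  by (simp add: minus_l2_circle_def uminus_l2_circle_def)

lemma cinner_abs_l2_circle:
  assumes "square_integrable f" "square_integrable g"
  shows "cinner (abs_l2_circle f) (abs_l2_circle g) = (LINT x|circle_measure. f x * cnj (g x))"
  using assms by (simp add: cinner_l2_circle.abs_eq l2_rel_refl)

lemma norm_abs_l2_circle:
  assumes "square_integrable f"
  shows "(norm (abs_l2_circle f))\<^sup>2 = (LINT x|circle_measure. (cmod (f x))\<^sup>2)"
proof -
  have "(norm (abs_l2_circle f))\<^sup>2 = Re (cinner (abs_l2_circle f) (abs_l2_circle f))"
    by (simp add: Re_cinner power2_norm_eq_inner)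
  also have "\<dots> = (LINT x|circle_measure. (cmod (f x))\<^sup>2)"
    by (simp only: cinner_abs_l2_circle assms complex_norm_square[symmetric]
        integral_complex_of_real Re_complex_of_real)
  finally show ?thesis .
qed

lemma abs_l2_circle_sum:
  assumes "finite S" "\<And>n. n \<in> S \<Longrightarrow> square_integrable (f n)"
  shows "square_integrable (\<lambda>x. \<Sum>n\<in>S. f n x)
    \<and> abs_l2_circle (\<lambda>x. \<Sum>n\<in>S. f n x) = (\<Sum>n\<in>S. abs_l2_circle (f n))"
  using assms
  by (induction S rule: finite_induct)
    (auto simp: square_integrable_0 square_integrable_add abs_l2_circle_add zero_l2_circle_def)

text \<open>Dominated convergence for \<open>(cmod (g k x - f x))\<^sup>2\<close>, with the
  dominating function obtained from (a + b)^2 \<le> 2 a^2 + 2 b^2.\<close>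

lemma abs_l2_circle_tendsto:
  assumes g: "\<And>k. square_integrable (g k)" and f: "square_integrable f"
    and lim: "AE x in circle_measure. (\<lambda>k. g k x) \<longlonglongrightarrow> f x"
    and w: "integrable circle_measure (\<lambda>x. (w x)\<^sup>2)"
    and le: "\<And>k. AE x in circle_measure. cmod (g k x) \<le> w x"
  shows "(\<lambda>k. abs_l2_circle (g k)) \<longlonglongrightarrow> abs_l2_circle f"
proof -
  have [measurable]: "g k \<in> borel_measurable circle_measure" "f \<in> borel_measurable circle_measure" for k
    using g f by (auto simp: square_integrable_def)
  have "(\<lambda>k. LINT x|circle_measure. (cmod (g k x - f x))\<^sup>2) \<longlonglongrightarrow> (LINT x|circle_measure. 0)"
  proof (rule integral_dominated_convergence)
    show "integrable circle_measure (\<lambda>x. 2 * (w x)\<^sup>2 + 2 * (cmod (f x))\<^sup>2)"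
      using w f by (auto simp: square_integrable_def)
    show "AE x in circle_measure. (\<lambda>k. (cmod (g k x - f x))\<^sup>2) \<longlonglongrightarrow> 0"
      using lim
    proof eventually_elim
      case (elim x)
      have "(\<lambda>k. (cmod (g k x - f x))\<^sup>2) \<longlonglongrightarrow> (cmod (f x - f x))\<^sup>2"
        by (intro tendsto_intros elim)
      then show ?case by simp
    qed
    show "AE x in circle_measure. norm ((cmod (g k x - f x))\<^sup>2) \<le> 2 * (w x)\<^sup>2 + 2 * (cmod (f x))\<^sup>2" for k
      using le[of k]
    proof eventually_elim
      case (elim x)
      have "(cmod (g k x - f x))\<^sup>2 \<le> (w x + cmod (f x))\<^sup>2"
        using elim norm_triangle_ineq4[of "g k x" "f x"] by (intro power_mono) auto
      also have "\<dots> \<le> 2 * (w x)\<^sup>2 + 2 * (cmod (f x))\<^sup>2"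
        using sum_squares_bound[of "w x" "cmod (f x)"] by (simp add: power2_sum)
      finally show ?case by simp
    qed
  qed measurable
  then have "(\<lambda>k. (norm (abs_l2_circle (g k) - abs_l2_circle f))\<^sup>2) \<longlonglongrightarrow> 0"
    using g f by (simp add: abs_l2_circle_diff[symmetric] norm_abs_l2_circle square_integrable_diff)
  then have "(\<lambda>k. sqrt ((norm (abs_l2_circle (g k) - abs_l2_circle f))\<^sup>2)) \<longlonglongrightarrow> sqrt 0"
    by (rule tendsto_real_sqrt)
  then show ?thesis
    by (simp add: LIM_zero_iff tendsto_norm_zero_iff)
qed

section \<open>The algebra of trigonometric polynomials\<close>

lemma trig_poly_exp: "trig_poly (\<lambda>x. a * exp (\<i> * of_int n * complex_of_real x))"
  unfolding trig_poly_def by (intro exI[of _ "{n}"] exI[of _ "\<lambda>_. a"]) auto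

lemma trig_poly_const: "trig_poly (\<lambda>x. a)"
  using trig_poly_exp[of a 0] by simp

text \<open>The frequency map \<open>h\<close> may repeat values; terms of equal frequency are
  collected. This is what sums and products require.\<close>

lemma trig_poly_sum:
  assumes "finite S"
  shows "trig_poly (\<lambda>x. \<Sum>j\<in>S. b j * exp (\<i> * of_int (h j) * complex_of_real x))"
  unfolding trig_poly_def
proof (intro exI conjI ext)
  show "finite (h ` S)"
    using assms by simp
  fix x
  show "(\<Sum>j\<in>S. b j * exp (\<i> * of_int (h j) * complex_of_real x)) =
    (\<Sum>n\<in>h ` S. (\<Sum>j | j \<in> S \<and> h j = n. b j) * exp (\<i> * of_int n * complex_of_real x))"
    by (subst sum.image_gen[OF assms, of _ h])
      (auto intro!: sum.cong simp: sum_distrib_right)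
qed

lemma trig_poly_add:
  assumes "trig_poly p" "trig_poly q"
  shows "trig_poly (\<lambda>x. p x + q x)"
proof -
  obtain S :: "int set" and a where S: "finite S"
    and p: "p = (\<lambda>x. \<Sum>n\<in>S. a n * exp (\<i> * of_int n * complex_of_real x))"
    using assms(1) by (auto simp: trig_poly_def)
  obtain R :: "int set" and b where R: "finite R"
    and q: "q = (\<lambda>x. \<Sum>n\<in>R. b n * exp (\<i> * of_int n * complex_of_real x))"
    using assms(2) by (auto simp: trig_poly_def)
  \<comment> \<open>The disjoint sum keeps frequencies common to \<open>p\<close> and
    \<open>q\<close> apart; \<open>trig_poly_sum\<close> merges them afterwards.\<close>
  have "(\<lambda>x. p x + q x) = (\<lambda>x. \<Sum>j\<in>S <+> R. (case j of Inl n \<Rightarrow> a n | Inr n \<Rightarrow> b n) *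
      exp (\<i> * of_int (case j of Inl n \<Rightarrow> n | Inr n \<Rightarrow> n) * complex_of_real x))"
    using S R by (simp add: p q sum.Plus)
  then show ?thesis
    using trig_poly_sum[of "S <+> R"] S R by simp
qed

lemma trig_poly_mult:
  assumes "trig_poly p" "trig_poly q"
  shows "trig_poly (\<lambda>x. p x * q x)"
proof -
  obtain S :: "int set" and a where S: "finite S"
    and p: "p = (\<lambda>x. \<Sum>n\<in>S. a n * exp (\<i> * of_int n * complex_of_real x))"
    using assms(1) by (auto simp: trig_poly_def)
  obtain R :: "int set" and b where R: "finite R"
    and q: "q = (\<lambda>x. \<Sum>n\<in>R. b n * exp (\<i> * of_int n * complex_of_real x))"
    using assms(2) by (auto simp: trig_poly_def)
  have "(\<lambda>x. p x * q x) = (\<lambda>x. \<Sum>j\<in>S \<times> R. (a (fst j) * b (snd j)) *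
      exp (\<i> * of_int (fst j + snd j) * complex_of_real x))"
    by (auto simp: p q sum_product sum.cartesian_product exp_add algebra_simps intro!: sum.cong ext)
  then show ?thesis
    using trig_poly_sum[of "S \<times> R" "\<lambda>j. a (fst j) * b (snd j)" "\<lambda>j. fst j + snd j"] S R by simp
qed

lemma trig_poly_cos: "trig_poly (\<lambda>x. complex_of_real (cos x))"
proof -
  have "(\<lambda>x. complex_of_real (cos x)) = (\<lambda>x. 1/2 * exp (\<i> * of_int 1 * complex_of_real x)
      + 1/2 * exp (\<i> * of_int (-1) * complex_of_real x))"
    by (auto simp: cos_of_real[symmetric] cos_exp_eq field_simps)
  then show ?thesis
    using trig_poly_add[OF trig_poly_exp trig_poly_exp] by metis
qed

lemma trig_poly_sin: "trig_poly (\<lambda>x. complex_of_real (sin x))"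
proof -
  have "(\<lambda>x. complex_of_real (sin x)) = (\<lambda>x. (1/(2*\<i>)) * exp (\<i> * of_int 1 * complex_of_real x)
      + (-1/(2*\<i>)) * exp (\<i> * of_int (-1) * complex_of_real x))"
    by (auto simp: sin_of_real[symmetric] sin_exp_eq field_simps)
  then show ?thesis
    using trig_poly_add[OF trig_poly_exp trig_poly_exp] by metis
qed

text \<open>Link to Stone-Weierstrass: a polynomial in the real coordinates of a point on the circle
  is a polynomial in its cosine and sine.\<close>

lemma trig_poly_real_polynomial_function_cis:
  assumes "real_polynomial_function q"
  shows "trig_poly (\<lambda>x. complex_of_real (q (cis x)))"
  using assms
proof induction
  case (linear f)
  interpret bounded_linear f by fact
  have "f (cis x) = cos x * f 1 + sin x * f \<i>" for x
  proof -
    have "cis x = cos x *\<^sub>R 1 + sin x *\<^sub>R \<i>"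
      by (simp add: complex_eq_iff)
    then show ?thesis by (simp add: add scaleR)
  qed
  then show ?case
    by (auto intro!: trig_poly_add trig_poly_mult trig_poly_cos trig_poly_sin trig_poly_const)
qed (auto intro: trig_poly_add trig_poly_mult trig_poly_const)

lemma trig_poly_polynomial_function_cis:
  assumes "polynomial_function q"
  shows "trig_poly (\<lambda>x. q (cis x) :: complex)"
proof -
  have "real_polynomial_function (\<lambda>z. Re (q z))" "real_polynomial_function (\<lambda>z. Im (q z))"
    using assms bounded_linear_Re bounded_linear_Im by (auto simp: polynomial_function_def o_def)
  from this[THEN trig_poly_real_polynomial_function_cis]
  have "trig_poly (\<lambda>x. complex_of_real (Re (q (cis x))) + \<i> * complex_of_real (Im (q (cis x))))"
    by (intro trig_poly_add trig_poly_mult trig_poly_const)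
  then show ?thesis
    by (simp add: complex_eq[symmetric])
qed


section \<open>Uniform approximation implies approximation in norm\<close>

lemma norm_abs_l2_circle_le:
  assumes f: "square_integrable f" and le: "\<And>x. x \<in> {0..2*pi} \<Longrightarrow> cmod (f x) \<le> B"
  shows "norm (abs_l2_circle f) \<le> B * sqrt (2 * pi)"
proof -
  have B: "0 \<le> B"
    using le[of 0] norm_ge_zero[of "f 0"] pi_gt_zero by (simp del: norm_ge_zero)
  have "(norm (abs_l2_circle f))\<^sup>2 \<le> (LINT x|circle_measure. B\<^sup>2)"
    unfolding norm_abs_l2_circle[OF f]
    using f le by (intro integral_mono) (auto simp: square_integrable_def intro!: power_mono)
  also have "\<dots> = (B * sqrt (2 * pi))\<^sup>2"
    by (simp add: power_mult_distrib measure_restrict_space)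
  finally show ?thesis
    by (rule power2_le_imp_le) (use B in simp)
qed

text \<open>The norm is at most \<open>sqrt (2 * pi)\<close> times a uniform bound. The filter is
  arbitrary so as to cover both sequences and nets of finite partial sums.\<close>

lemma abs_l2_circle_tendsto_uniform:
  assumes g: "\<And>k. square_integrable (g k)" and f: "square_integrable f"
    and lim: "uniform_limit {0..2*pi} g f F"
  shows "((\<lambda>k. abs_l2_circle (g k)) \<longlongrightarrow> abs_l2_circle f) F"
proof (rule tendstoI)
  fix e :: real assume e: "0 < e"
  define d where "d = e / (2 * sqrt (2 * pi))"
  have d: "0 < d" "d * sqrt (2 * pi) < e"
    using e by (auto simp: d_def)
  from uniform_limitD[OF lim d(1)]
  show "\<forall>\<^sub>F k in F. dist (abs_l2_circle (g k)) (abs_l2_circle f) < e"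
  proof eventually_elim
    case (elim k)
    have "norm (abs_l2_circle (\<lambda>x. g k x - f x)) \<le> d * sqrt (2 * pi)"
      using elim by (intro norm_abs_l2_circle_le square_integrable_diff g f) (auto simp: dist_norm less_imp_le)
    then show ?case
      using d(2) by (simp add: dist_norm abs_l2_circle_diff g f)
  qed
qed

section \<open>Density for continuous periodic, then bounded, then arbitrary functions\<close>

abbreviation trig_closure :: "l2_circle set" where
  "trig_closure \<equiv> closure {abs_l2_circle p |p. trig_poly p}"

lemma cis_image: "cis ` {0..2*pi} = sphere 0 1"
proof
  show "sphere 0 1 \<subseteq> cis ` {0..2*pi}"
  proof
    fix z :: complex assume "z \<in> sphere 0 1"
    then have "z = cis (Arg2pi z)"
      using Arg2pi_eq[of z] by (simp add: cis_conv_exp)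
    moreover have "Arg2pi z \<in> {0..2*pi}"
      using Arg2pi_ge_0[of z] Arg2pi_lt_2pi[of z] by simp
    ultimately show "z \<in> cis ` {0..2*pi}"
      by blast
  qed
qed auto

text \<open>The interval has length one period, so arguments with equal \<open>cis\<close> differ by
  at most one period, and by a full one only at the ends.\<close>

lemma cis_eq_cases:
  assumes "cis x = cis y" "x \<in> {0..2*pi}" "y \<in> {0..2*pi}"
  shows "x = y \<or> {x, y} = {0, 2*pi}"
proof -
  have "sin x = sin y \<and> cos x = cos y"
    using assms(1) by (simp add: complex_eq_iff)
  then obtain n :: int where n: "x = y + 2 * pi * n"
    using sin_cos_eq_iff[of x y] by blast
  have "\<bar>x - y\<bar> \<le> 2 * pi"
    using assms(2,3) by auto
  then have "\<bar>real_of_int n\<bar> \<le> 1"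
    by (simp add: n abs_mult)
  then have "n = -1 \<or> n = 0 \<or> n = 1"
    by linarith
  then show ?thesis
    using n assms(2,3) by auto
qed

text \<open>On the compact interval \<open>cis\<close> is a quotient map onto the circle, and equal
  end values make \<open>g\<close> constant on its fibres, so \<open>g\<close> descends.\<close>

lemma continuous_on_circle_factor:
  fixes g :: "real \<Rightarrow> complex"
  assumes g: "continuous_on {0..2*pi} g" "g 0 = g (2*pi)"
  obtains h where "continuous_on (sphere 0 1) h" "\<And>x. x \<in> {0..2*pi} \<Longrightarrow> h (cis x) = g x"
proof
  define h where "h z = g (SOME x. x \<in> {0..2*pi} \<and> cis x = z)" for z
  show h: "h (cis x) = g x" if x: "x \<in> {0..2*pi}" for x
  proof -
    define y where "y = (SOME y. y \<in> {0..2*pi} \<and> cis y = cis x)"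
    have "y \<in> {0..2*pi} \<and> cis y = cis x"
      unfolding y_def by (rule someI[of _ x]) (use x in auto)
    then have "g y = g x"
      using cis_eq_cases[of x y] x g(2) by (auto simp: doubleton_eq_iff)
    then show ?thesis
      by (simp only: h_def y_def)
  qed
  show "continuous_on (sphere 0 1) h"
    unfolding continuous_on_open_gen[of h "sphere 0 1" UNIV, simplified]
  proof (intro allI impI)
    have c: "continuous_on {0..2*pi} cis"
      by (intro continuous_intros)
    fix U :: "complex set" assume "open U"
    then have "openin (top_of_set {0..2*pi}) ({0..2*pi} \<inter> g -` U)"
      using g(1) by (simp add: continuous_openin_preimage_gen)
    also have "{0..2*pi} \<inter> g -` U = {0..2*pi} \<inter> cis -` (sphere 0 1 \<inter> h -` U)"
      using h by auto
    finally show "openin (top_of_set (sphere 0 1)) (sphere 0 1 \<inter> h -` U)"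
      by (subst (asm) Abstract_Topology_2.continuous_imp_quotient_map[OF c cis_image]) auto
  qed
qed

text \<open>Stone-Weierstrass approximates the factored function on the circle by polynomials;
  composing them with \<open>cis\<close> gives trigonometric polynomials that converge uniformly to
  \<open>g\<close>.\<close>

lemma trig_closure_continuous:
  assumes g: "continuous_on {0..2*pi} g" "g 0 = g (2*pi)"
  shows "abs_l2_circle g \<in> trig_closure"
proof -
  obtain h where h: "continuous_on (sphere 0 1) h" "\<And>x. x \<in> {0..2*pi} \<Longrightarrow> h (cis x) = g x"
    using continuous_on_circle_factor[OF g] by blast
  have "\<exists>q. polynomial_function q \<and> (\<forall>z\<in>sphere 0 1. norm (h z - q z) < inverse (Suc n))" for n
    by (rule Stone_Weierstrass_polynomial_function[OF _ h(1)]) auto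
  then obtain q where q: "\<And>n. polynomial_function (q n)"
    "\<And>n z. z \<in> sphere 0 1 \<Longrightarrow> norm (h z - q n z) < inverse (Suc n)"
    by metis
  have t: "trig_poly (\<lambda>x. q n (cis x))" for n
    using trig_poly_polynomial_function_cis[OF q(1)] .
  have "uniform_limit {0..2*pi} (\<lambda>n x. q n (cis x)) g sequentially"
  proof (rule uniform_limitI)
    fix e :: real assume "0 < e"
    then have "\<forall>\<^sub>F n in sequentially. inverse (real (Suc n)) < e"
      using order_tendstoD(2)[OF LIMSEQ_inverse_real_of_nat] by blast
    then show "\<forall>\<^sub>F n in sequentially. \<forall>x\<in>{0..2*pi}. dist (q n (cis x)) (g x) < e"
    proof eventually_elim
      case (elim n)
      show ?case
      proof
        fix x assume x: "x \<in> {0..2*pi}"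
        have "norm (h (cis x) - q n (cis x)) < inverse (Suc n)"
          by (rule q(2)) simp
        then show "dist (q n (cis x)) (g x) < e"
          using elim h(2)[OF x] by (simp add: dist_norm norm_minus_commute)
      qed
    qed
  qed
  then have "(\<lambda>n. abs_l2_circle (\<lambda>x. q n (cis x))) \<longlonglongrightarrow> abs_l2_circle g"
    by (intro abs_l2_circle_tendsto_uniform square_integrable_D(1) t square_integrable_continuous g)
  then show ?thesis
    unfolding closure_sequential by (intro exI[of _ "\<lambda>n. abs_l2_circle (\<lambda>x. q n (cis x))"]) (use t in blast)
qed

text \<open>For positive \<open>r\<close> this is the radial retraction onto the closed disc of
  radius \<open>r\<close>. The maximum keeps the denominator at least 1, which makes continuity
  immediate.\<close>

definition clip :: "real \<Rightarrow> complex \<Rightarrow> complex" where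
  "clip r z = z / complex_of_real (max 1 (cmod z / r))"

lemma continuous_on_clip [continuous_intros]:
  assumes "continuous_on S f" "r > 0"
  shows "continuous_on S (\<lambda>x. clip r (f x))"
  unfolding clip_def by (intro continuous_intros assms) (use assms in auto)

lemma clip_eq: "r > 0 \<Longrightarrow> cmod z \<le> r \<Longrightarrow> clip r z = z"
  by (simp add: clip_def max_def field_simps)

lemma norm_clip_le:
  assumes "r > 0"
  shows "cmod (clip r z) \<le> r" "cmod (clip r z) \<le> cmod z"
  using assms by (auto simp: clip_def norm_divide max_def field_simps)

lemma AE_circle_interior: "AE x in circle_measure. x \<in> {0<..<2*pi}"
proof -
  have "AE x in lebesgue. x \<noteq> 0 \<and> x \<noteq> 2*pi"
    using AE_lborel_singleton[of 0] AE_lborel_singleton[of "2*pi"]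
    by (intro AE_completion) auto
  then show ?thesis
    by (subst AE_restrict_space_iff) (force elim!: eventually_mono)+
qed

text \<open>A measurable function is an almost everywhere limit of continuous ones. Clipping these
  at \<open>r\<close> makes them dominated, a cut-off makes their end values equal, and the
  continuous case applies.\<close>

lemma trig_closure_bounded:
  assumes f: "square_integrable f" and r: "r > 0" and le: "\<And>x. x \<in> {0..2*pi} \<Longrightarrow> cmod (f x) \<le> r"
  shows "abs_l2_circle f \<in> trig_closure"
proof -
  have "f measurable_on {0..2*pi}"
    using f by (simp add: measurable_on_iff_borel_measurable square_integrable_def)
  then obtain N g where N: "negligible N" and g: "\<And>n. continuous_on UNIV (g n)"
    and lim: "\<And>x. x \<notin> N \<Longrightarrow> (\<lambda>n. g n x) \<longlonglongrightarrow> (if x \<in> {0..2*pi} then f x else 0)"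
    unfolding measurable_on_def by blast
  \<comment> \<open>The cut-off vanishes at both ends and equals 1 at any given interior point for
    all large \<open>n\<close>.\<close>
  define u where "u n x = min 1 (real n * x) * min 1 (real n * (2*pi - x))" for n x
  define h where "h n x = complex_of_real (u n x) * clip r (g n x)" for n x
  have cu: "continuous_on S (u n)" for S n
    unfolding u_def by (intro continuous_intros)
  have ch: "continuous_on {0..2*pi} (h n)" for n
    unfolding h_def
    by (intro continuous_intros cu r continuous_on_subset[OF g]) auto
  have u1: "\<bar>u n x\<bar> \<le> 1" if "x \<in> {0..2*pi}" for n x
  proof -
    have "0 \<le> real n * x" "0 \<le> real n * (2*pi - x)"
      using that by auto
    then show ?thesis
      by (auto simp: u_def abs_mult intro!: mult_le_one)
  qed
  have lim_h: "(\<lambda>n. abs_l2_circle (h n)) \<longlonglongrightarrow> abs_l2_circle f"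
  proof (rule abs_l2_circle_tendsto)
    show "square_integrable (h n)" for n
      by (intro square_integrable_continuous ch)
    show "integrable circle_measure (\<lambda>x. r\<^sup>2)"
      by (simp add: finite_measure.integrable_const finite_measure_lebesgue_on)
    show "AE x in circle_measure. cmod (h n x) \<le> r" for n
    proof (rule AE_I2)
      fix x assume "x \<in> space circle_measure"
      then have "\<bar>u n x\<bar> * cmod (clip r (g n x)) \<le> 1 * r"
        using u1[of x n] r norm_clip_le(1)[of r] by (intro mult_mono) auto
      then show "cmod (h n x) \<le> r"
        by (simp add: h_def norm_mult)
    qed
    have "AE x in lebesgue. x \<notin> N"
      using N by (simp add: negligible_iff_null_sets AE_not_in)
    then have "AE x in circle_measure. x \<notin> N"
      by (subst AE_restrict_space_iff) (auto elim!: eventually_mono)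
    with AE_circle_interior
    show "AE x in circle_measure. (\<lambda>n. h n x) \<longlonglongrightarrow> f x"
    proof eventually_elim
      case (elim x)
      have "(\<lambda>n. g n x) \<longlonglongrightarrow> f x"
        using lim[of x] elim by simp
      moreover have "continuous_on UNIV (clip r)"
        using continuous_on_clip[OF continuous_on_id r, of UNIV] by simp
      ultimately have "(\<lambda>n. clip r (g n x)) \<longlonglongrightarrow> clip r (f x)"
        using continuous_on_tendsto_compose[of UNIV "clip r"] by simp
      moreover have "clip r (f x) = f x"
        using le[of x] elim r by (simp add: clip_eq)
      moreover have "(\<lambda>n. u n x) \<longlonglongrightarrow> 1"
      proof -
        have "filterlim (\<lambda>n. real n * c) at_top sequentially" if "0 < c" for c
          using filterlim_tendsto_pos_mult_at_top[OF tendsto_const that filterlim_real_sequentially]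
          by (simp add: mult.commute)
        then have "\<forall>\<^sub>F n in sequentially. 1 \<le> real n * c" if "0 < c" for c
          using that by (auto simp: filterlim_at_top)
        then have "\<forall>\<^sub>F n in sequentially. 1 \<le> real n * x \<and> 1 \<le> real n * (2*pi - x)"
          using elim by (intro eventually_conj) auto
        then have "\<forall>\<^sub>F n in sequentially. u n x = 1"
          by eventually_elim (simp add: u_def)
        then show ?thesis
          by (simp add: tendsto_eventually)
      qed
      ultimately have "(\<lambda>n. h n x) \<longlonglongrightarrow> complex_of_real 1 * f x"
        unfolding h_def by (intro tendsto_mult tendsto_of_real) auto
      then show ?case by simp
    qed
  qed fact
  have mem_h: "abs_l2_circle (h n) \<in> trig_closure" for n
    by (rule trig_closure_continuous[OF ch]) (simp add: h_def u_def)
  show ?thesis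
    by (rule closed_sequentially[OF closed_closure mem_h lim_h])
qed

text \<open>The truncations of \<open>f\<close> are bounded, dominated by \<open>f\<close>, and at
  each point eventually equal to it.\<close>

lemma trig_closure_UNIV: "trig_closure = UNIV"
proof -
  have "abs_l2_circle f \<in> trig_closure" if f: "square_integrable f" for f
  proof -
    have [measurable]: "f \<in> borel_measurable circle_measure"
      using f by (auto simp: square_integrable_def)
    \<comment> \<open>\<open>Suc n\<close> keeps the radius positive also for
      \<open>n = 0\<close>.\<close>
    define g where "g n x = clip (Suc n) (f x)" for n x
    have [measurable]: "clip (Suc n) \<in> borel_measurable borel" for n
      using continuous_on_clip[OF continuous_on_id, of "Suc n" UNIV]
      by (intro borel_measurable_continuous_onI) auto
    have g: "square_integrable (g n)" for n
      unfolding square_integrable_def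
    proof
      show m [measurable]: "g n \<in> borel_measurable circle_measure"
        unfolding g_def by measurable
      have "integrable circle_measure (\<lambda>x. (cmod (f x))\<^sup>2)"
        using f by (simp add: square_integrable_def)
      moreover have "(\<lambda>x. (cmod (g n x))\<^sup>2) \<in> borel_measurable circle_measure"
        by measurable
      ultimately show "integrable circle_measure (\<lambda>x. (cmod (g n x))\<^sup>2)"
        by (rule Bochner_Integration.integrable_bound)
          (auto intro!: AE_I2 power_mono norm_clip_le(2) simp: g_def simp del: of_nat_Suc)
    qed
    have lim_g: "(\<lambda>n. abs_l2_circle (g n)) \<longlonglongrightarrow> abs_l2_circle f"
    proof (rule abs_l2_circle_tendsto)
      show "integrable circle_measure (\<lambda>x. (cmod (f x))\<^sup>2)"
        using f by (simp add: square_integrable_def)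
      show "AE x in circle_measure. cmod (g n x) \<le> cmod (f x)" for n
        by (auto simp: g_def intro!: norm_clip_le)
      have "(\<lambda>n. g n x) \<longlonglongrightarrow> f x" for x
      proof (rule tendsto_eventually)
        obtain m where "cmod (f x) \<le> real m"
          using real_arch_simple by blast
        then show "\<forall>\<^sub>F n in sequentially. g n x = f x"
          by (intro eventually_sequentiallyI[of m]) (auto simp: g_def intro!: clip_eq)
      qed
      then show "AE x in circle_measure. (\<lambda>n. g n x) \<longlonglongrightarrow> f x"
        by simp
    qed fact+
    have mem_g: "abs_l2_circle (g n) \<in> trig_closure" for n
      by (rule trig_closure_bounded[OF g, of "Suc n"]) (auto simp: g_def intro!: norm_clip_le)
    show ?thesis
      by (rule closed_sequentially[OF closed_closure mem_g lim_g])
  qed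
  then have "x \<in> trig_closure" for x
    by (cases x rule: l2_circle_cases) simp
  then show ?thesis
    by blast
qed

section \<open>The Fourier basis\<close>

definition fourier_exp :: "int \<Rightarrow> real \<Rightarrow> complex" where
  "fourier_exp n x = exp (\<i> * of_int n * complex_of_real x)"

lemma continuous_on_fourier_exp [continuous_intros]: "continuous_on S (fourier_exp n)"
  unfolding fourier_exp_def by (intro continuous_intros)

lemma norm_fourier_exp [simp]: "cmod (fourier_exp n x) = 1"
  by (simp add: fourier_exp_def)

lemma fourier_exp_add: "fourier_exp m x * fourier_exp n x = fourier_exp (m + n) x"
  by (simp add: fourier_exp_def algebra_simps flip: exp_add)

lemma fourier_exp_cnj: "cnj (fourier_exp n x) = fourier_exp (- n) x"
  by (simp add: fourier_exp_def exp_cnj)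

lemma square_integrable_fourier_exp: "square_integrable (fourier_exp n)"
  by (intro square_integrable_continuous continuous_intros)

lemma integral_fourier_exp:
  "(LINT x|circle_measure. fourier_exp n x) = (if n = 0 then 2 * pi else 0)"
proof -
  have "integrable circle_measure (fourier_exp n)"
    using integrable_mult_cnj[OF square_integrable_fourier_exp[of n] square_integrable_fourier_exp[of 0]]
    by (simp add: fourier_exp_cnj fourier_exp_add)
  then have *: "(LINT x|circle_measure. fourier_exp n x) = integral {0..2*pi} (fourier_exp n)"
    by (intro lebesgue_integral_eq_integral) auto
  show ?thesis
  proof (cases "n = 0")
    case True
    then have "fourier_exp n = (\<lambda>x. 1)"
      by (auto simp: fourier_exp_def)
    then show ?thesis
      unfolding * using True by (simp add: scaleR_conv_of_real)
  next
    case False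
    \<comment> \<open>This antiderivative takes equal values at 0 and 2 pi, so the integral
      vanishes.\<close>
    define F where "F x = fourier_exp n x / (\<i> * of_int n)" for x
    have "(F has_vector_derivative fourier_exp n x) (at x within {0..2*pi})" for x
    proof -
      have "((\<lambda>z. exp (\<i> * of_int n * z) / (\<i> * of_int n)) has_field_derivative
          exp (\<i> * of_int n * of_real x)) (at (of_real x))"
        using False by (auto intro!: derivative_eq_intros)
      from has_vector_derivative_real_field[OF this] show ?thesis
        by (simp add: F_def[abs_def] fourier_exp_def[abs_def] has_vector_derivative_at_within)
    qed
    then have "(fourier_exp n has_integral F (2*pi) - F 0) {0..2*pi}"
      by (intro fundamental_theorem_of_calculus) auto
    moreover have "fourier_exp n (2*pi) = 1" "fourier_exp n 0 = 1"
      using exp_integer_2pi[of "of_int n"] by (auto simp: fourier_exp_def mult_ac)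
    ultimately show ?thesis
      using False by (simp add: * F_def integral_unique)
  qed
qed

definition fourier_basis :: "int \<Rightarrow> l2_circle" where
  "fourier_basis n = complex_of_real (1 / sqrt (2*pi)) *\<^sub>C abs_l2_circle (fourier_exp n)"

lemma abs_fourier_exp: "abs_l2_circle (fourier_exp n) = complex_of_real (sqrt (2*pi)) *\<^sub>C fourier_basis n"
  by (simp add: fourier_basis_def scaleC_scaleC scaleC_one flip: of_real_mult)

lemma cinner_fourier_exp:
  "cinner (abs_l2_circle (fourier_exp m)) (abs_l2_circle (fourier_exp n)) = (if m = n then 2 * pi else 0)"
  using integral_fourier_exp[of "m - n"]
  by (simp add: cinner_abs_l2_circle square_integrable_fourier_exp fourier_exp_cnj fourier_exp_add)

lemma abs_trig_sum:
  assumes "finite S"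
  shows "abs_l2_circle (\<lambda>x. \<Sum>n\<in>S. a n * fourier_exp (h n) x)
    = (\<Sum>n\<in>S. (a n * complex_of_real (sqrt (2*pi))) *\<^sub>C fourier_basis (h n))"
  using abs_l2_circle_sum[OF assms, of "\<lambda>n x. a n * fourier_exp (h n) x"]
  by (simp add: square_integrable_mult square_integrable_fourier_exp abs_l2_circle_mult
      abs_fourier_exp scaleC_scaleC)

lemma trig_poly_iff:
  "trig_poly p \<longleftrightarrow> (\<exists>S a. finite S \<and> p = (\<lambda>x. \<Sum>n\<in>S. a n * fourier_exp n x))"
  by (simp add: trig_poly_def fourier_exp_def)

text \<open>Exponentials and unit vectors differ by the factor \<open>k\<close>, which the arbitrary
  coefficients absorb. \<open>P\<close> is left open so that the identity and both differential
  operators are covered.\<close>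

lemma trig_graph_eq:
  assumes P: "\<And>S a. finite S \<Longrightarrow> P (\<lambda>x. \<Sum>n\<in>S. a n * fourier_exp n x)
      = (\<lambda>x. \<Sum>n\<in>S. (a n * d n) * fourier_exp (n + s) x)"
  shows "{(abs_l2_circle p, abs_l2_circle (P p)) |p. trig_poly p} =
    {(\<Sum>n\<in>S. a n *\<^sub>C fourier_basis n, \<Sum>n\<in>S. (a n * d n) *\<^sub>C fourier_basis (n + s)) | S a. finite S}"
    (is "?L = ?R")
proof -
  define k where "k = complex_of_real (sqrt (2*pi))"
  have k: "k \<noteq> 0"
    by (simp add: k_def)
  have abs: "(abs_l2_circle (\<lambda>x. \<Sum>n\<in>S. a n * fourier_exp n x),
      abs_l2_circle (P (\<lambda>x. \<Sum>n\<in>S. a n * fourier_exp n x))) =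
      (\<Sum>n\<in>S. (a n * k) *\<^sub>C fourier_basis n, \<Sum>n\<in>S. (a n * k * d n) *\<^sub>C fourier_basis (n + s))"
    if "finite S" for S a
    using abs_trig_sum[OF that, of a "\<lambda>n. n"] abs_trig_sum[OF that, of "\<lambda>n. a n * d n" "\<lambda>n. n + s"]
    by (simp add: P[OF that] k_def mult_ac)
  show ?thesis
  proof (rule set_eqI, rule iffI)
    fix z assume "z \<in> ?L"
    then obtain S a where "finite S" "z = (abs_l2_circle (\<lambda>x. \<Sum>n\<in>S. a n * fourier_exp n x),
        abs_l2_circle (P (\<lambda>x. \<Sum>n\<in>S. a n * fourier_exp n x)))"
      unfolding trig_poly_iff by blast
    then have "z = (\<Sum>n\<in>S. (a n * k) *\<^sub>C fourier_basis n,
        \<Sum>n\<in>S. (a n * k * d n) *\<^sub>C fourier_basis (n + s))"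
      using abs by simp
    with \<open>finite S\<close> show "z \<in> ?R"
      by (intro CollectI exI[of _ S] exI[of _ "\<lambda>n. a n * k"] conjI)
  next
    fix z assume "z \<in> ?R"
    then obtain S a where S: "finite S"
      and z: "z = (\<Sum>n\<in>S. a n *\<^sub>C fourier_basis n, \<Sum>n\<in>S. (a n * d n) *\<^sub>C fourier_basis (n + s))"
      by blast
    have "z = (abs_l2_circle (\<lambda>x. \<Sum>n\<in>S. a n / k * fourier_exp n x),
        abs_l2_circle (P (\<lambda>x. \<Sum>n\<in>S. a n / k * fourier_exp n x)))"
      using abs[OF S, of "\<lambda>n. a n / k"] k by (simp add: z)
    moreover have "trig_poly (\<lambda>x. \<Sum>n\<in>S. a n / k * fourier_exp n x)"
      unfolding trig_poly_iff by (rule exI[of _ S], rule exI[of _ "\<lambda>n. a n / k"]) (simp add: S)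
    ultimately show "z \<in> ?L"
      by (intro CollectI exI conjI)
  qed
qed

interpretation fourier: orthonormal_basis fourier_basis
proof
  have k: "complex_of_real (sqrt (2*pi)) * complex_of_real (sqrt (2*pi)) = 2 * pi"
    by (simp flip: of_real_mult)
  show ortho: "cinner (fourier_basis m) (fourier_basis n) = (if m = n then 1 else 0)" for m n
    using k by (simp add: fourier_basis_def cinner_scaleC_left cinner_scaleC_right cinner_fourier_exp
        field_simps)
  \<comment> \<open>Taking \<open>P\<close> to be the identity, the first components identify
    trigonometric polynomials with finite combinations of the basis.\<close>
  have "Domain {(abs_l2_circle p, abs_l2_circle p) |p. trig_poly p} =
      Domain {(\<Sum>n\<in>S. a n *\<^sub>C fourier_basis n, \<Sum>n\<in>S. (a n * 1) *\<^sub>C fourier_basis (n + 0)) | S a. finite S}"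
    by (subst trig_graph_eq[where d = "\<lambda>_. 1" and s = 0]) simp_all
  then have "{abs_l2_circle p |p. trig_poly p} = {\<Sum>n\<in>S. a n *\<^sub>C fourier_basis n | S a. finite S}"
    by (simp add: Domain_unfold) fast
  then show "closure {\<Sum>n\<in>S. a n *\<^sub>C fourier_basis n | S a. finite S} = UNIV"
    using trig_closure_UNIV by simp
  fix a :: "int \<Rightarrow> complex"
  assume a: "(\<lambda>n. cmod (a n)) summable_on UNIV"
  define b where "b n = a n / complex_of_real (sqrt (2*pi))" for n
  \<comment> \<open>The Weierstrass test makes this series uniformly convergent, so \<open>f\<close>
    is continuous and hence square integrable.\<close>
  define f where "f x = (\<Sum>\<^sub>\<infinity>n. b n * fourier_exp n x)" for x
  have "(\<lambda>n. cmod (a n) * (1 / sqrt (2*pi))) summable_on UNIV"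
    using a by (rule summable_on_cmult_left)
  then have lim: "uniform_limit {0..2*pi} (\<lambda>F x. \<Sum>n\<in>F. b n * fourier_exp n x) f (finite_subsets_at_top UNIV)"
    unfolding f_def by (intro Weierstrass_m_test_general) (auto simp: b_def norm_mult norm_divide)
  then have f: "continuous_on {0..2*pi} f"
    by (rule uniform_limit_theorem[rotated]) (auto intro!: always_eventually continuous_intros)
  have "square_integrable (\<lambda>x. \<Sum>n\<in>F. b n * fourier_exp n x)" for F
    by (intro square_integrable_continuous continuous_intros)
  then have lim: "((\<lambda>F. abs_l2_circle (\<lambda>x. \<Sum>n\<in>F. b n * fourier_exp n x)) \<longlongrightarrow> abs_l2_circle f)
      (finite_subsets_at_top UNIV)"
    by (rule abs_l2_circle_tendsto_uniform[OF _ square_integrable_continuous[OF f] lim])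
  have "cinner (abs_l2_circle f) (fourier_basis m) = a m" for m
  proof (rule tendsto_unique)
    show "((\<lambda>F. cinner (abs_l2_circle (\<lambda>x. \<Sum>n\<in>F. b n * fourier_exp n x)) (fourier_basis m))
        \<longlongrightarrow> cinner (abs_l2_circle f) (fourier_basis m)) (finite_subsets_at_top UNIV)"
      by (intro cinner.tendsto lim tendsto_const)
    \<comment> \<open>Once \<open>F\<close> contains \<open>m\<close>, the \<open>m\<close>-th
      coefficient of the partial sum is exactly \<open>a m\<close>.\<close>
    have "\<forall>\<^sub>F F in finite_subsets_at_top UNIV.
        cinner (abs_l2_circle (\<lambda>x. \<Sum>n\<in>F. b n * fourier_exp n x)) (fourier_basis m) = a m"
      unfolding eventually_finite_subsets_at_top
    proof (intro exI[of _ "{m}"] conjI allI impI)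
      fix F assume F: "finite F \<and> {m} \<subseteq> F \<and> F \<subseteq> (UNIV :: int set)"
      show "cinner (abs_l2_circle (\<lambda>x. \<Sum>n\<in>F. b n * fourier_exp n x)) (fourier_basis m) = a m"
        using F abs_trig_sum[of F b "\<lambda>n. n"]
        by (simp add: ortho b_def cinner.sum_left cinner_scaleC_left if_distrib cong: if_cong)
    qed auto
    then show "((\<lambda>F. cinner (abs_l2_circle (\<lambda>x. \<Sum>n\<in>F. b n * fourier_exp n x)) (fourier_basis m))
        \<longlongrightarrow> a m) (finite_subsets_at_top UNIV)"
      by (rule tendsto_eventually)
  qed simp
  then show "\<exists>x. \<forall>n. cinner x (fourier_basis n) = a n"
    by blast
qed

section \<open>The two differential operators as weighted shifts\<close>

lemma D_fun_trig:
  assumes "finite S"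
  shows "D_fun b c (\<lambda>x. \<Sum>n\<in>S. a n * fourier_exp n x)
    = (\<lambda>x. \<Sum>n\<in>S. (a n * (b * of_int n + c)) * fourier_exp n x)"
proof
  fix x
  have "((\<lambda>z. \<Sum>n\<in>S. a n * exp (\<i> * of_int n * z)) has_field_derivative
      (\<Sum>n\<in>S. a n * (\<i> * of_int n) * exp (\<i> * of_int n * of_real x))) (at (of_real x))"
    by (auto intro!: derivative_eq_intros sum.cong)
  from vector_derivative_at[OF has_vector_derivative_real_field[OF this]]
  show "D_fun b c (\<lambda>x. \<Sum>n\<in>S. a n * fourier_exp n x) x
    = (\<Sum>n\<in>S. (a n * (b * of_int n + c)) * fourier_exp n x)"
    by (simp add: D_fun_def fourier_exp_def sum_distrib_left sum.distrib[symmetric] algebra_simps)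
qed

lemma D_op_eq: "D_op b c = fourier.weighted_shift (\<lambda>n. b * of_int n + c) 0"
  unfolding D_op_def fourier.weighted_shift_eq_closure
  by (subst trig_graph_eq[where d = "\<lambda>n. b * of_int n + c" and s = 0]) (simp_all add: D_fun_trig)

text \<open>The factor exp(ix) raises every frequency by one, which turns the diagonal operator into
  a shift by 1 with the same weights.\<close>

lemma D_tilde_op_eq: "D_tilde_op b c = fourier.weighted_shift (\<lambda>n. b * of_int n + c) 1"
proof -
  have exp: "exp (\<i> * complex_of_real x) * fourier_exp n x = fourier_exp (n + 1) x" for n x
    using fourier_exp_add[of 1 x n] by (simp add: fourier_exp_def add.commute)
  have "D_tilde_fun b c (\<lambda>x. \<Sum>n\<in>S. a n * fourier_exp n x)
      = (\<lambda>x. \<Sum>n\<in>S. (a n * (b * of_int n + c)) * fourier_exp (n + 1) x)" if "finite S" for S a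
    unfolding D_tilde_fun_def[abs_def] D_fun_trig[OF that]
    by (simp add: exp[symmetric] sum_distrib_left mult.left_commute)
  then show ?thesis
    unfolding D_tilde_op_def fourier.weighted_shift_eq_closure
    by (subst trig_graph_eq[where d = "\<lambda>n. b * of_int n + c" and s = 1]) simp_all
qed

section \<open>Summability of the weights and the conclusion\<close>

lemma summable_on_int_inverse_squares: "(\<lambda>n::int. 1 / (real_of_int n)\<^sup>2) summable_on UNIV"
proof -
  \<comment> \<open>At 0 the value is 0, by the convention for division by zero.\<close>
  define g where "g n = 1 / (real_of_int n)\<^sup>2" for n
  have "summable (\<lambda>n. 1 / (real n)\<^sup>2)"
    using inverse_power_summable[of 2, where ?'a = real] by (simp add: inverse_eq_divide)
  then have nat: "(\<lambda>n. 1 / (real n)\<^sup>2) summable_on UNIV"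
    by (intro norm_summable_imp_summable_on) simp
  have "g summable_on range int" "g summable_on range (\<lambda>n. - int n)"
    using nat by (simp_all add: summable_on_reindex inj_on_def o_def g_def)
  then have "g summable_on (range int \<union> range (\<lambda>n. - int n))"
    by (rule summable_on_union)
  moreover have "range int \<union> range (\<lambda>n. - int n) = UNIV"
    by (auto intro: int_cases2)
  ultimately show ?thesis
    by (simp add: g_def[abs_def])
qed

lemma summable_on_affine_weights:
  fixes b c :: complex
  assumes b: "b \<noteq> 0"
  shows "(\<lambda>n::int. 1 / (1 + (cmod (b * of_int n + c))\<^sup>2)) summable_on UNIV"
proof -
  \<comment> \<open>The constant comes from |b n| \<le> w + |c| with w = |b n + c|: squaring gives
    |b n|^2 \<le> 2 w^2 + 2 |c|^2 \<le> (2 + 2 |c|^2)(1 + w^2).\<close>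
  define k where "k = (2 + 2 * (cmod c)\<^sup>2) / (cmod b)\<^sup>2"
  have "(\<lambda>n::int. k * (1 / (real_of_int n)\<^sup>2)) summable_on UNIV"
    by (intro summable_on_cmult_right summable_on_int_inverse_squares)
  \<comment> \<open>The index 0 is set aside because the majorant is 0 there and the comparison
    fails.\<close>
  then have "(\<lambda>n::int. k * (1 / (real_of_int n)\<^sup>2)) summable_on - {0}"
    by (rule summable_on_subset_banach) simp
  then have "(\<lambda>n::int. 1 / (1 + (cmod (b * of_int n + c))\<^sup>2)) summable_on - {0}"
  proof (rule summable_on_comparison_test)
    fix n :: int assume "n \<in> - {0}"
    then have n: "n \<noteq> 0" by simp
    define w where "w = cmod (b * of_int n + c)"
    have "cmod (b * of_int n) \<le> w + cmod c"
      unfolding w_def using norm_triangle_ineq4[of "b * of_int n + c" c] by simp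
    then have "(cmod b * \<bar>real_of_int n\<bar>)\<^sup>2 \<le> (w + cmod c)\<^sup>2"
      by (intro power_mono) (auto simp: norm_mult)
    also have "\<dots> \<le> 2 * w\<^sup>2 + 2 * (cmod c)\<^sup>2"
      using sum_squares_bound[of w "cmod c"] by (simp add: power2_sum)
    also have "\<dots> \<le> (2 + 2 * (cmod c)\<^sup>2) * (1 + w\<^sup>2)"
      by (simp add: algebra_simps)
    finally have "(cmod b)\<^sup>2 * (real_of_int n)\<^sup>2 \<le> (2 + 2 * (cmod c)\<^sup>2) * (1 + w\<^sup>2)"
      by (simp add: power_mult_distrib)
    moreover have "0 < 1 + w\<^sup>2"
      by (simp add: add_pos_nonneg)
    ultimately show "1 / (1 + (cmod (b * of_int n + c))\<^sup>2) \<le> k * (1 / (real_of_int n)\<^sup>2)"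
      unfolding w_def[symmetric] using b n by (simp add: k_def field_simps)
  qed simp
  then have "(\<lambda>n::int. 1 / (1 + (cmod (b * of_int n + c))\<^sup>2)) summable_on insert 0 (- {0})"
    by (simp only: summable_on_insert_iff)
  then show ?thesis
    by (simp add: Compl_eq_Diff_UNIV insert_absorb)
qed

text \<open>For \<open>b = 0\<close> the weights are constantly \<open>c\<close>, which rules out
  compact parametrices even if \<open>c = 0\<close>; for \<open>b \<noteq> 0\<close> they grow
  linearly and the summability criterion applies.\<close>

lemma compact_parametrices_iff:
  "has_compact_parametrices (fourier.weighted_shift (\<lambda>n. b * of_int n + c) s) \<longleftrightarrow> b \<noteq> 0"
  using fourier.weighted_shift_compact_parametrices[OF summable_on_affine_weights]
    fourier.constant_weight_not_compact_parametrices[of c s]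
  by auto

theorem proposition6p2:
  fixes \<beta> :: "int \<Rightarrow> complex" and \<beta>_plus \<beta>_minus c :: complex
  assumes "((\<lambda>k. \<beta> k - \<beta> (k - 1)) \<longlongrightarrow> \<beta>_plus) at_top"
    and "((\<lambda>k. \<beta> k - \<beta> (k - 1)) \<longlongrightarrow> \<beta>_minus) at_bot"
  shows "(has_compact_parametrices (D_op \<beta>_plus c) \<longleftrightarrow> \<beta>_plus \<noteq> 0)
    \<and> (has_compact_parametrices (D_tilde_op \<beta>_plus c) \<longleftrightarrow> \<beta>_plus \<noteq> 0)
    \<and> (has_compact_parametrices (D_op \<beta>_minus c) \<longleftrightarrow> \<beta>_minus \<noteq> 0)
    \<and> (has_compact_parametrices (D_tilde_op \<beta>_minus c) \<longleftrightarrow> \<beta>_minus \<noteq> 0)"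
  \<comment> \<open>All four equivalences are instances of one criterion, with shift 0 or 1 and
    either limit as \<open>b\<close>.\<close>
  by (simp add: D_op_eq D_tilde_op_eq compact_parametrices_iff)

end
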